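(* Let $Q$ be an $n\times n$ Hermitian positive definite matrix, $A$ an $mn\times n$ matrix, $\Delta A$ an $mn\times n$ matrix, $\Delta Q\in\mathcal{H}^n$, and put $\tilde A=A+\Delta A$, $\tilde Q=Q+\Delta Q$, with $\tilde Q>0$. Suppose that the equation $X+A^*\widehat{X}^{-1}A=Q$ has a maximal positive definite solution $X_L$. Let $P$ be an $n\times n$ positive definite matrix, let $\|\cdot\|_U$ be a unitarily invariant norm, and let \begin{align*} b_p&=1-K_U^P\big\|\widehat{PX_L^{-1}}AP^{-1}\big\|+\|PX_L^{-1}P\|\,\|P^{-1}\Delta Q P^{-1}\|_U,\\ c_p&=\|P^{-1}\Delta QP^{-1}\|_U+2\big\|\widehat{PX_L^{-1}}AP^{-1}\big\|\,\big\|\widehat{P^{-1}}\Delta A P^{-1}\big\|_U+\|PX_L^{-1}P\|\,\big\|\widehat{P^{-1}}\Delta AP^{-1}\big\|_U^2, \end{align*} where $$K_U^P=\min\big\{\theta_U(m)\,\big\|\widehat{PX_L^{-1}}AP^{-1}\big\|,\ \big\|\widehat{PX_L^{-1}}AP^{-1}\big\|_U\big\}.$$ If $K_U^P\big\|\widehat{PX_L^{-1}}AP^{-1}\big\|<1$ and $$2\big\|\widehat{P^{-1}}\Delta AP^{-1}\big\|_U+\|P^{-1}\Delta QP^{-1}\|_U<\frac{\Big(1-\sqrt{K_U^P\big\|\widehat{PX_L^{-1}}AP^{-1}\big\|}\Big)^2}{\|PX_L^{-1}P\|},$$ then $D_p:=b_p^2-4c_p\|PX_L^{-1}P\|>0$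 and $$\|\Delta X_L\|_U\le\|P\|^2\,\frac{b_p-\sqrt{D_p}}{2\|PX_L^{-1}P\|}=:S_{err}^P,$$ where $\Delta X_L=\tilde X_L-X_L$ and $\tilde X_L$ is the maximal positive definite solution of the perturbed equation $\tilde X+\tilde A^*\widehat{\tilde X^{-1}}\tilde A=\tilde Q$.
   Context: $\mathcal{H}^n$ is the set of $n\times n$ Hermitian matrices; $M>0$ ($M\ge 0$) means $M$ is positive definite (semidefinite), and $M\ge N$ means $M-N\ge 0$. $A^*$ is the conjugate transpose. For an $n\times n$ matrix $Z$, $\widehat{Z}=I_m\otimes Z=\mathrm{diag}(Z,\dots,Z)$ is the $m\times m$ block diagonal matrix with $Z$ on its diagonal; in particular $\widehat{Z}^{-1}=\widehat{Z^{-1}}$. A Hermitian solution $X_L$ of such an equation is called maximal if $X_L\ge X$ for an arbitrary Hermitian solution $X$; a maximal positive definite solution is a maximal solution that is positive definite. $\|\cdot\|$ is the spectral norm and $\|\cdot\|_U$ is any unitarily invariant matrix norm, used on matrices of different sizes and having the usual properties $\|Z\|\le\|Z\|_U$ and $\|XYZ\|_U\le\|X\|\,\|Y\|_U\,\|Z\|$. The quantity $\theta_U(m)$ is defined by $\theta_U(m)=\|\widehat{Z}\|_U/\|Z\|_U$ for an $n\times n$ (nonzero) matrix $Z$; for the spectral norm its value is $1$ and for the Frobenius norm it is $\sqrt m$.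
   Formalization: The bound is proved for every maximal positive definite solution X̃_L of the perturbed equation; its existence is assumed, not concluded, because with maximality over all Hermitian solutions it can fail for m>1 under the stated hypotheses. *)

theory Defs
  imports Complex_Main
    "Jordan_Normal_Form.Schur_Decomposition"
    "Jordan_Normal_Form.Gauss_Jordan_Elimination"
begin

section \<open>Hermitian matrices and the Loewner order\<close>

definition hermitian_mat :: "nat \<Rightarrow> complex mat \<Rightarrow> bool" where
  "hermitian_mat n M \<longleftrightarrow> M \<in> carrier_mat n n \<and> mat_adjoint M = M"

text \<open>For Hermitian \<open>M\<close> the number \<open>(M *\<^sub>v v) \<bullet>c v\<close>, i.e. \<open>v\<^sup>* M v\<close>, is real, so taking
  the real part below loses nothing.\<close>

definition pos_def_mat :: "nat \<Rightarrow> complex mat \<Rightarrow> bool" where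
  "pos_def_mat n M \<longleftrightarrow> hermitian_mat n M \<and>
     (\<forall>v \<in> carrier_vec n. v \<noteq> 0\<^sub>v n \<longrightarrow> 0 < Re ((M *\<^sub>v v) \<bullet>c v))"

definition pos_semidef_mat :: "nat \<Rightarrow> complex mat \<Rightarrow> bool" where
  "pos_semidef_mat n M \<longleftrightarrow> hermitian_mat n M \<and>
     (\<forall>v \<in> carrier_vec n. 0 \<le> Re ((M *\<^sub>v v) \<bullet>c v))"

definition loewner_ge :: "nat \<Rightarrow> complex mat \<Rightarrow> complex mat \<Rightarrow> bool" where
  "loewner_ge n M N \<longleftrightarrow> pos_semidef_mat n (M - N)"

section \<open>Inverse and block diagonal repetition\<close>

text \<open>Meaningful only for invertible arguments.\<close>

definition mat_inv :: "complex mat \<Rightarrow> complex mat" where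
  "mat_inv M = the (mat_inverse M)"

text \<open>The matrix \<open>I\<^sub>m \<otimes> Z = diag(Z, \<dots>, Z)\<close>.\<close>

definition hat :: "nat \<Rightarrow> complex mat \<Rightarrow> complex mat" where
  "hat m Z = diag_block_mat (replicate m Z)"

section \<open>The matrix equation and its maximal solution\<close>

text \<open>Hermitian solutions of \<open>X + A\<^sup>* (hat X)\<^sup>-\<^sup>1 A = Q\<close>. Since \<open>mat_inv\<close> is total, the
  invertibility of \<open>X\<close> has to be stated.\<close>

definition hermitian_solution ::
  "nat \<Rightarrow> nat \<Rightarrow> complex mat \<Rightarrow> complex mat \<Rightarrow> complex mat \<Rightarrow> bool" where
  "hermitian_solution m n A Q X \<longleftrightarrow> hermitian_mat n X \<and> invertible_mat X \<and>
     X + mat_adjoint A * mat_inv (hat m X) * A = Q"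

text \<open>Maximality is with respect to all Hermitian solutions, not only the positive definite ones.\<close>

definition maximal_solution ::
  "nat \<Rightarrow> nat \<Rightarrow> complex mat \<Rightarrow> complex mat \<Rightarrow> complex mat \<Rightarrow> bool" where
  "maximal_solution m n A Q X \<longleftrightarrow> hermitian_solution m n A Q X \<and>
     (\<forall>Y. hermitian_solution m n A Q Y \<longrightarrow> loewner_ge n X Y)"

definition maximal_pos_def_solution ::
  "nat \<Rightarrow> nat \<Rightarrow> complex mat \<Rightarrow> complex mat \<Rightarrow> complex mat \<Rightarrow> bool" where
  "maximal_pos_def_solution m n A Q X \<longleftrightarrow> maximal_solution m n A Q X \<and> pos_def_mat n X"

section \<open>Norms\<close>

definition l2_vec_norm :: "complex vec \<Rightarrow> real" where
  "l2_vec_norm v = sqrt (\<Sum>i<dim_vec v. (cmod (v $ i))\<^sup>2)"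

text \<open>The spectral norm, as the operator norm induced by the Euclidean norm; the closed unit ball
  rather than the sphere is used so that the set is nonempty also without columns.\<close>

definition spectral_norm :: "complex mat \<Rightarrow> real" where
  "spectral_norm M = (SUP v \<in> {v \<in> carrier_vec (dim_col M). l2_vec_norm v \<le> 1}. l2_vec_norm (M *\<^sub>v v))"

definition unitary_mat :: "nat \<Rightarrow> complex mat \<Rightarrow> bool" where
  "unitary_mat k U \<longleftrightarrow> U \<in> carrier_mat k k \<and> mat_adjoint U * U = 1\<^sub>m k"

text \<open>A unitarily invariant norm, given simultaneously on the complex matrices of every size. The
  last two conditions, relating it to the spectral norm and linking the sizes with each other, are
  part of the convention on such norms.\<close>

definition unitarily_invariant_norm :: "(complex mat \<Rightarrow> real) \<Rightarrow> bool" where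
  "unitarily_invariant_norm \<nu> \<longleftrightarrow>
     (\<forall>r c. \<forall>Z \<in> carrier_mat r c. 0 \<le> \<nu> Z \<and> (\<nu> Z = 0 \<longleftrightarrow> Z = 0\<^sub>m r c)) \<and>
     (\<forall>a Z. \<nu> (a \<cdot>\<^sub>m Z) = cmod a * \<nu> Z) \<and>
     (\<forall>r c. \<forall>Y \<in> carrier_mat r c. \<forall>Z \<in> carrier_mat r c. \<nu> (Y + Z) \<le> \<nu> Y + \<nu> Z) \<and>
     (\<forall>r c U V. \<forall>Z \<in> carrier_mat r c. unitary_mat r U \<longrightarrow> unitary_mat c V \<longrightarrow> \<nu> (U * Z * V) = \<nu> Z) \<and>
     (\<forall>Z. spectral_norm Z \<le> \<nu> Z) \<and>
     (\<forall>p q r s. \<forall>X \<in> carrier_mat p q. \<forall>Y \<in> carrier_mat q r. \<forall>Z \<in> carrier_mat r s.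
        \<nu> (X * Y * Z) \<le> spectral_norm X * \<nu> Y * spectral_norm Z)"

text \<open>\<open>t\<close> is the value of \<open>\<nu> (hat Z) / \<nu> Z\<close>, which does not depend on the nonzero
  \<open>n \<times> n\<close> matrix \<open>Z\<close>.\<close>

definition is_theta :: "(complex mat \<Rightarrow> real) \<Rightarrow> nat \<Rightarrow> nat \<Rightarrow> real \<Rightarrow> bool" where
  "is_theta \<nu> m n t \<longleftrightarrow> (\<forall>Z \<in> carrier_mat n n. Z \<noteq> 0\<^sub>m n n \<longrightarrow> t = \<nu> (hat m Z) / \<nu> Z)"

end

theory Submission
  imports Defs "HOL-Analysis.L2_Norm"
begin

text \<open>Congruence with \<open>P\<^sup>-\<^sup>1\<close> turns the equation into one of the same form and respects maximality,
  so the statement reduces to \<open>P = I\<close> (locale \<open>inverse_pair\<close>); the factor \<open>\<parallel>P\<parallel>\<^sup>2\<close> in the bound is the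
  price of transforming back. From now on \<open>X\<close> is the normalised maximal solution, \<open>V = X\<^sup>-\<^sup>1\<close>,
  \<open>W = hat V A\<close>, \<open>w = \<parallel>W\<parallel>\<close>, \<open>l = \<parallel>V\<parallel>\<close>.

  The matrix \<open>X + H\<close> solves the perturbed equation iff \<open>H\<close> is a fixed point of
  \<open>H \<mapsto> \<Delta>Q + A\<^sup>* hat V A - (A + \<Delta>A)\<^sup>* hat (X + H)\<^sup>-\<^sup>1 (A + \<Delta>A)\<close>. Writing
  \<open>(X + H)\<^sup>-\<^sup>1 = N V\<close> with \<open>N = (I + V H)\<^sup>-\<^sup>1\<close>, \<open>\<parallel>N\<parallel> \<le> 1 / (1 - l h)\<close>, the image of a Hermitian \<open>H\<close> of
  norm at most \<open>h\<close> has norm at most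
  \<open>dQ + (K w h + 2 w dA + l dA\<^sup>2) / (1 - l h)\<close>. This number equals \<open>h\<close> exactly when
  \<open>l h\<^sup>2 - b h + c = 0\<close>, and for the smaller root \<open>h\<close> of this quadratic the ball of radius \<open>h\<close> is
  therefore mapped to itself. The smallness hypothesis makes the discriminant positive and, at the same
  time, gives \<open>l h + w + l dA < 1\<close> (lemma \<open>quadratic_bound\<close>). The last inequality says that
  \<open>B = hat (X + H)\<^sup>-\<^sup>1 (A + \<Delta>A)\<close> has spectral norm below \<open>1\<close> for every \<open>H\<close> in the ball; as the
  difference of two values of the map at \<open>G\<close> and \<open>H\<close> is \<open>B\<^sub>G\<^sup>* hat (H - G) B\<^sub>H\<close>, the map is a contraction
  in the spectral norm, and Banach's theorem yields a solution \<open>Y = X + H\<close> with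
  \<open>\<nu> H \<le> h\<close> (lemma \<open>perturbed_solution_exists\<close>).

  It remains to see that \<open>Y\<close> is the maximal solution \<open>Z\<close> and not just some solution
  (lemma \<open>loewner_ge_imp_eq\<close>). By maximality \<open>F = Z - Y \<ge> 0\<close>, and subtracting the two equations gives
  \<open>F = B\<^sup>* hat (F - F Z\<^sup>-\<^sup>1 F) B \<le> B\<^sup>* hat F B\<close>. Since \<open>\<parallel>B\<parallel> < 1\<close>, iterating this inequality forces
  \<open>F = 0\<close>.

  The norm estimate uses \<open>\<nu> (M\<^sup>*) \<le> \<nu> M\<close>, a consequence of the polar decomposition
  (lemma \<open>uin_adjoint\<close>). It needs no spectral theorem: Newton-Schulz iteration
  produces approximate unitary polar factors, and these suffice by continuity of \<open>\<nu>\<close>.\<close>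

section \<open>Matrix algebra with dimension side conditions\<close>

text \<open>Carrier predicates carry dimensions that do not occur in the terms to be rewritten, so they are of
  little use as conditions of rewrite rules. Side conditions on \<open>dim_row\<close> and \<open>dim_col\<close> are solved by
  the simplifier, also for rectangular products.\<close>

lemma mult_assoc_dim:
  fixes A B C :: "complex mat"
  assumes "dim_col A = dim_row B" "dim_col B = dim_row C"
  shows "A * B * C = A * (B * C)"
  by (rule assoc_mult_mat[of _ "dim_row A" "dim_row B" _ "dim_row C" _ "dim_col C"]) (use assms in auto)

lemma add_mult_dim:
  fixes A B C :: "complex mat"
  assumes "dim_row A = dim_row B" "dim_col A = dim_col B" "dim_col B = dim_row C"
  shows "(A + B) * C = A * C + B * C"
  by (rule add_mult_distrib_mat[of _ "dim_row A" "dim_row C" _ _ "dim_col C"]) (use assms in auto)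

lemma minus_mult_dim:
  fixes A B C :: "complex mat"
  assumes "dim_row A = dim_row B" "dim_col A = dim_col B" "dim_col B = dim_row C"
  shows "(A - B) * C = A * C - B * C"
  by (rule minus_mult_distrib_mat[of _ "dim_row A" "dim_row C" _ _ "dim_col C"]) (use assms in auto)

lemma mult_add_dim:
  fixes A B C :: "complex mat"
  assumes "dim_row B = dim_row C" "dim_col B = dim_col C" "dim_col A = dim_row B"
  shows "A * (B + C) = A * B + A * C"
  by (rule mult_add_distrib_mat[of _ "dim_row A" "dim_row B" _ "dim_col C"]) (use assms in auto)

lemma mult_minus_dim:
  fixes A B C :: "complex mat"
  assumes "dim_row B = dim_row C" "dim_col B = dim_col C" "dim_col A = dim_row B"
  shows "A * (B - C) = A * B - A * C"
  by (rule mult_minus_distrib_mat[of _ "dim_row A" "dim_row B" _ "dim_col C"]) (use assms in auto)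

lemma one_mult_dim:
  fixes A :: "complex mat"
  shows "dim_row A = k \<Longrightarrow> 1\<^sub>m k * A = A" "dim_col A = k \<Longrightarrow> A * 1\<^sub>m k = A"
  by (auto intro!: left_mult_one_mat right_mult_one_mat)

lemma zero_mult_dim:
  fixes A :: "complex mat"
  shows "dim_row A = k \<Longrightarrow> 0\<^sub>m r k * A = 0\<^sub>m r (dim_col A)"
    "dim_col A = k \<Longrightarrow> A * 0\<^sub>m k c = 0\<^sub>m (dim_row A) c"
  by (auto intro!: eq_matI)

lemma zero_add_dim:
  fixes A :: "complex mat"
  shows "dim_row A = r \<Longrightarrow> dim_col A = c \<Longrightarrow> 0\<^sub>m r c + A = A"
    "dim_row A = r \<Longrightarrow> dim_col A = c \<Longrightarrow> A + 0\<^sub>m r c = A"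
  by (auto intro!: eq_matI)

lemma adjoint_dim [simp]:
  fixes A :: "complex mat"
  shows "dim_row (mat_adjoint A) = dim_col A" "dim_col (mat_adjoint A) = dim_row A"
  by (auto simp: mat_adjoint_def)

lemma adjoint_index [simp]:
  fixes A :: "complex mat"
  shows "i < dim_col A \<Longrightarrow> j < dim_row A \<Longrightarrow> mat_adjoint A $$ (i, j) = cnj (A $$ (j, i))"
  by (auto simp: mat_adjoint_def mat_of_rows_def)

lemma adjoint_adjoint [simp]: "mat_adjoint (mat_adjoint A) = (A :: complex mat)"
  by (rule eq_matI) auto

lemma adjoint_one [simp]: "mat_adjoint (1\<^sub>m k) = (1\<^sub>m k :: complex mat)"
  by (rule eq_matI) auto

lemma adjoint_zero [simp]: "mat_adjoint (0\<^sub>m r c) = (0\<^sub>m c r :: complex mat)"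
  by (rule eq_matI) auto

lemma adjoint_add:
  fixes A B :: "complex mat"
  assumes "dim_row A = dim_row B" "dim_col A = dim_col B"
  shows "mat_adjoint (A + B) = mat_adjoint A + mat_adjoint B"
  by (rule eq_matI) (use assms in auto)

lemma adjoint_minus:
  fixes A B :: "complex mat"
  assumes "dim_row A = dim_row B" "dim_col A = dim_col B"
  shows "mat_adjoint (A - B) = mat_adjoint A - mat_adjoint B"
  by (rule eq_matI) (use assms in auto)

lemma adjoint_mult:
  fixes A B :: "complex mat"
  assumes "dim_col A = dim_row B"
  shows "mat_adjoint (A * B) = mat_adjoint B * mat_adjoint A"
  by (rule eq_matI) (use assms in \<open>auto simp: scalar_prod_def intro!: sum.cong\<close>)

lemma scalar_prod_adjoint:
  fixes A :: "complex mat"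
  assumes "dim_vec v = dim_col A" "dim_vec u = dim_row A"
  shows "(A *\<^sub>v v) \<bullet>c u = v \<bullet>c (mat_adjoint A *\<^sub>v u)"
proof -
  have "(A *\<^sub>v v) \<bullet>c u = (\<Sum>i<dim_row A. \<Sum>j<dim_col A. A $$ (i, j) * v $ j * cnj (u $ i))"
    using assms by (simp add: scalar_prod_def atLeast0LessThan sum_distrib_right)
  also have "\<dots> = (\<Sum>j<dim_col A. \<Sum>i<dim_row A. A $$ (i, j) * v $ j * cnj (u $ i))"
    by (rule sum.swap)
  also have "\<dots> = v \<bullet>c (mat_adjoint A *\<^sub>v u)"
    using assms by (simp add: scalar_prod_def atLeast0LessThan sum_distrib_left mult_ac)
  finally show ?thesis .
qed

lemma mult_mult_vec_dim:
  fixes A B :: "complex mat"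
  assumes "dim_col A = dim_row B" "dim_col B = dim_vec v"
  shows "A * B *\<^sub>v v = A *\<^sub>v (B *\<^sub>v v)"
  by (rule assoc_mult_mat_vec[of _ "dim_row A" "dim_row B" _ "dim_vec v"])
    (use assms in \<open>auto intro!: carrier_matI carrier_vecI\<close>)

lemma add_mult_vec_dim:
  fixes A B :: "complex mat"
  assumes "dim_row A = dim_row B" "dim_col A = dim_vec v" "dim_col B = dim_vec v"
  shows "(A + B) *\<^sub>v v = A *\<^sub>v v + B *\<^sub>v v"
  by (rule add_mult_distrib_mat_vec[of _ "dim_row A" "dim_vec v"])
    (use assms in \<open>auto intro!: carrier_matI carrier_vecI\<close>)

lemma minus_mult_vec_dim:
  fixes A B :: "complex mat"
  assumes "dim_row A = dim_row B" "dim_col A = dim_vec v" "dim_col B = dim_vec v"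
  shows "(A - B) *\<^sub>v v = A *\<^sub>v v - B *\<^sub>v v"
  by (rule minus_mult_distrib_mat_vec[of _ "dim_row A" "dim_vec v"])
    (use assms in \<open>auto intro!: carrier_matI carrier_vecI\<close>)

lemma smult_mult_dim:
  fixes A B :: "complex mat"
  assumes "dim_col A = dim_row B"
  shows "(a \<cdot>\<^sub>m A) * B = a \<cdot>\<^sub>m (A * B)" "A * (a \<cdot>\<^sub>m B) = a \<cdot>\<^sub>m (A * B)"
proof -
  have "A \<in> carrier_mat (dim_row A) (dim_row B)" "B \<in> carrier_mat (dim_row B) (dim_col B)"
    using assms by (auto intro!: carrier_matI)
  then show "(a \<cdot>\<^sub>m A) * B = a \<cdot>\<^sub>m (A * B)" "A * (a \<cdot>\<^sub>m B) = a \<cdot>\<^sub>m (A * B)"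
    by (rule mult_smult_assoc_mat, rule mult_smult_distrib)
qed

lemma adjoint_smult:
  fixes A :: "complex mat"
  shows "mat_adjoint (a \<cdot>\<^sub>m A) = cnj a \<cdot>\<^sub>m mat_adjoint A"
  by (rule eq_matI) auto

lemmas mat_dim_algebra = mult_assoc_dim add_mult_dim minus_mult_dim mult_add_dim mult_minus_dim
  one_mult_dim smult_mult_dim adjoint_add adjoint_minus adjoint_mult adjoint_smult

lemma one_mult_vec_dim:
  fixes v :: "complex vec"
  shows "dim_vec v = n \<Longrightarrow> 1\<^sub>m n *\<^sub>v v = v"
  by (rule one_mult_mat_vec) (rule carrier_vecI)

section \<open>Block diagonal repetition\<close>

lemma hat_0 [simp]: "hat 0 Z = 0\<^sub>m 0 0"
  by (simp add: hat_def)

lemma hat_dim [simp]: "dim_row (hat m Z) = m * dim_row Z" "dim_col (hat m Z) = m * dim_col Z"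
  by (auto simp: hat_def dim_diag_block_mat sum_list_replicate)

lemma hat_Suc:
  "hat (Suc m) Z = four_block_mat Z (0\<^sub>m (dim_row Z) (m * dim_col Z))
     (0\<^sub>m (m * dim_row Z) (dim_col Z)) (hat m Z)"
  using hat_dim[of m Z] unfolding hat_def by (simp add: Let_def)

lemma hat_mult:
  assumes "dim_col Y = dim_row Z"
  shows "hat m (Y * Z) = hat m Y * hat m Z"
proof (induction m)
  case (Suc m)
  have "hat (Suc m) Y * hat (Suc m) Z = four_block_mat
      (Y * Z + 0\<^sub>m (dim_row Y) (m * dim_col Y) * 0\<^sub>m (m * dim_row Z) (dim_col Z))
      (Y * 0\<^sub>m (dim_row Z) (m * dim_col Z) + 0\<^sub>m (dim_row Y) (m * dim_col Y) * hat m Z)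
      (0\<^sub>m (m * dim_row Y) (dim_col Y) * Z + hat m Y * 0\<^sub>m (m * dim_row Z) (dim_col Z))
      (0\<^sub>m (m * dim_row Y) (dim_col Y) * 0\<^sub>m (dim_row Z) (m * dim_col Z) + hat m Y * hat m Z)"
    unfolding hat_Suc by (rule mult_four_block_mat) (auto intro!: carrier_matI simp: assms)
  also have "\<dots> = hat (Suc m) (Y * Z)"
    using assms by (simp add: hat_Suc Suc zero_mult_dim zero_add_dim)
  finally show ?case by simp
qed simp

lemma hat_add:
  assumes "dim_row Y = dim_row Z" "dim_col Y = dim_col Z"
  shows "hat m (Y + Z) = hat m Y + hat m Z"
proof (induction m)
  case (Suc m)
  show ?case
    unfolding hat_Suc
    by (rule eq_matI) (use assms Suc in \<open>auto simp: Suc\<close>)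
qed simp

lemma hat_minus:
  assumes "dim_row Y = dim_row Z" "dim_col Y = dim_col Z"
  shows "hat m (Y - Z) = hat m Y - hat m Z"
proof (induction m)
  case (Suc m)
  show ?case
    unfolding hat_Suc
    by (rule eq_matI) (use assms Suc in \<open>auto simp: Suc\<close>)
qed (auto intro!: eq_matI)

lemma hat_adjoint: "hat m (mat_adjoint Z) = mat_adjoint (hat m Z)"
proof (induction m)
  case (Suc m)
  show ?case
    unfolding hat_Suc
    by (rule eq_matI) (auto simp: Suc)
qed simp

lemma hat_one [simp]: "hat m (1\<^sub>m n) = 1\<^sub>m (m * n)"
  by (induction m) (auto simp: hat_Suc intro!: eq_matI)

lemma hat_zero [simp]: "hat m (0\<^sub>m r c) = 0\<^sub>m (m * r) (m * c)"
  by (induction m) (simp_all add: hat_Suc)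

lemma hat_Suc_mult_vec:
  assumes "dim_vec v = dim_col Z" "dim_vec w = m * dim_col Z"
  shows "hat (Suc m) Z *\<^sub>v (v @\<^sub>v w) = (Z *\<^sub>v v) @\<^sub>v (hat m Z *\<^sub>v w)"
proof -
  have "hat (Suc m) Z *\<^sub>v (v @\<^sub>v w)
     = (Z *\<^sub>v v + 0\<^sub>m (dim_row Z) (m * dim_col Z) *\<^sub>v w)
       @\<^sub>v (0\<^sub>m (m * dim_row Z) (dim_col Z) *\<^sub>v v + hat m Z *\<^sub>v w)"
    unfolding hat_Suc
    by (rule four_block_mat_mult_vec) (auto intro!: carrier_matI carrier_vecI simp: assms)
  also have "0\<^sub>m (dim_row Z) (m * dim_col Z) *\<^sub>v w = 0\<^sub>v (dim_row Z)"
    using assms by (intro eq_vecI) (auto simp: scalar_prod_def)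
  also have "0\<^sub>m (m * dim_row Z) (dim_col Z) *\<^sub>v v = 0\<^sub>v (m * dim_row Z)"
    using assms by (intro eq_vecI) (auto simp: scalar_prod_def)
  also have "Z *\<^sub>v v + 0\<^sub>v (dim_row Z) = Z *\<^sub>v v"
    by (intro eq_vecI) auto
  also have "0\<^sub>v (m * dim_row Z) + hat m Z *\<^sub>v w = hat m Z *\<^sub>v w"
    by (intro eq_vecI) auto
  finally show ?thesis .
qed

section \<open>Euclidean norm and spectral norm\<close>

lemma l2_vec_norm_eq: "l2_vec_norm v = L2_set (\<lambda>i. cmod (v $ i)) {..<dim_vec v}"
  by (simp add: l2_vec_norm_def L2_set_def)

lemma l2_nonneg [simp]: "0 \<le> l2_vec_norm v"
  by (simp add: l2_vec_norm_eq L2_set_nonneg)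

lemma l2_sq: "Re (v \<bullet>c v) = (l2_vec_norm v)\<^sup>2"
proof -
  have "Re (v \<bullet>c v) = (\<Sum>i<dim_vec v. (cmod (v $ i))\<^sup>2)"
    by (simp add: scalar_prod_def atLeast0LessThan cmod_power2)
      (simp add: power2_eq_square)
  then show ?thesis by (simp add: l2_vec_norm_def sum_nonneg)
qed

lemma l2_eq_0: "l2_vec_norm v = 0 \<longleftrightarrow> v = 0\<^sub>v (dim_vec v)"
  by (auto simp: l2_vec_norm_eq L2_set_eq_0_iff intro!: eq_vecI)
    (metis index_zero_vec(1))

lemma l2_zero [simp]: "l2_vec_norm (0\<^sub>v k) = 0"
  by (simp add: l2_vec_norm_def)

lemma l2_smult: "l2_vec_norm (a \<cdot>\<^sub>v v) = cmod a * l2_vec_norm v"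
  by (simp add: l2_vec_norm_def norm_mult power_mult_distrib flip: sum_distrib_left)
    (simp add: real_sqrt_mult)

lemma cauchy_schwarz:
  assumes "dim_vec u = dim_vec v"
  shows "cmod (u \<bullet>c v) \<le> l2_vec_norm u * l2_vec_norm v"
proof -
  have "cmod (u \<bullet>c v) \<le> (\<Sum>i<dim_vec v. cmod (u $ i) * cmod (v $ i))"
    unfolding scalar_prod_def
    by (rule order.trans[OF norm_sum]) (auto simp: norm_mult atLeast0LessThan)
  also have "\<dots> \<le> l2_vec_norm u * l2_vec_norm v"
    unfolding l2_vec_norm_eq assms
    using L2_set_mult_ineq[of "\<lambda>i. cmod (u $ i)" "\<lambda>i. cmod (v $ i)"] by simp
  finally show ?thesis .
qed

lemma Re_scalar_prod_le:
  assumes "dim_vec u = dim_vec v"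
  shows "Re (u \<bullet>c v) \<le> l2_vec_norm u * l2_vec_norm v"
  using cauchy_schwarz[OF assms] complex_Re_le_cmod order.trans by blast

lemma l2_triangle:
  assumes "dim_vec u = dim_vec v"
  shows "l2_vec_norm (u + v) \<le> l2_vec_norm u + l2_vec_norm v"
proof -
  have "l2_vec_norm (u + v) \<le> L2_set (\<lambda>i. cmod (u $ i) + cmod (v $ i)) {..<dim_vec v}"
    unfolding l2_vec_norm_eq by (simp, rule L2_set_mono) (auto intro: norm_triangle_ineq)
  also have "\<dots> \<le> l2_vec_norm u + l2_vec_norm v"
    unfolding l2_vec_norm_eq assms by (rule L2_set_triangle_ineq)
  finally show ?thesis .
qed

lemma l2_append: "(l2_vec_norm (v @\<^sub>v w))\<^sup>2 = (l2_vec_norm v)\<^sup>2 + (l2_vec_norm w)\<^sup>2"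
proof -
  have "(\<Sum>i<dim_vec v + k. (cmod ((v @\<^sub>v w) $ i))\<^sup>2)
      = (\<Sum>i<dim_vec v. (cmod (v $ i))\<^sup>2) + (\<Sum>i<k. (cmod (w $ i))\<^sup>2)" if "k \<le> dim_vec w" for k
    using that by (induction k) auto
  then show ?thesis by (simp add: l2_vec_norm_def sum_nonneg)
qed

lemma l2_mult_bdd: "\<exists>C. \<forall>v. dim_vec v = dim_col M \<longrightarrow> l2_vec_norm (M *\<^sub>v v) \<le> C * l2_vec_norm v"
proof -
  have "l2_vec_norm (M *\<^sub>v v) \<le> (\<Sum>i<dim_row M. l2_vec_norm (conjugate (row M i))) * l2_vec_norm v"
    if "dim_vec v = dim_col M" for v
  proof -
    have "l2_vec_norm (M *\<^sub>v v) \<le> (\<Sum>i<dim_row M. cmod ((M *\<^sub>v v) $ i))"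
      unfolding l2_vec_norm_eq using L2_set_le_sum[of "{..<dim_row M}" "\<lambda>i. cmod ((M *\<^sub>v v) $ i)"] by simp
    also have "\<dots> \<le> (\<Sum>i<dim_row M. l2_vec_norm (conjugate (row M i)) * l2_vec_norm v)"
    proof (rule sum_mono)
      fix i assume "i \<in> {..<dim_row M}"
      then have "(M *\<^sub>v v) $ i = v \<bullet>c conjugate (row M i)"
        using that by (simp add: scalar_prod_def mult.commute)
      then show "cmod ((M *\<^sub>v v) $ i) \<le> l2_vec_norm (conjugate (row M i)) * l2_vec_norm v"
        using cauchy_schwarz[of v "conjugate (row M i)"] that by (simp add: mult.commute)
    qed
    finally show ?thesis by (simp add: sum_distrib_right)
  qed
  then show ?thesis by blast
qed

text \<open>Without boundedness the supremum defining the spectral norm would be an arbitrary value.\<close>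

lemma spectral_bdd:
  "bdd_above ((\<lambda>v. l2_vec_norm (M *\<^sub>v v)) ` {v \<in> carrier_vec (dim_col M). l2_vec_norm v \<le> 1})"
proof -
  obtain C where C: "\<And>v. dim_vec v = dim_col M \<Longrightarrow> l2_vec_norm (M *\<^sub>v v) \<le> C * l2_vec_norm v"
    using l2_mult_bdd by blast
  show ?thesis
  proof (rule bdd_aboveI2)
    fix v assume v: "v \<in> {v \<in> carrier_vec (dim_col M). l2_vec_norm v \<le> 1}"
    then have "l2_vec_norm (M *\<^sub>v v) \<le> C * l2_vec_norm v" by (intro C) auto
    also have "\<dots> \<le> \<bar>C\<bar> * 1" using v by (intro mult_mono) auto
    finally show "l2_vec_norm (M *\<^sub>v v) \<le> \<bar>C\<bar>" by simp
  qed
qed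

lemma spectral_nonneg [simp]: "0 \<le> spectral_norm M"
  unfolding spectral_norm_def
  by (rule cSUP_upper2[OF spectral_bdd, of "0\<^sub>v (dim_col M)"]) auto

lemma spectral_bound:
  assumes "dim_vec v = dim_col M"
  shows "l2_vec_norm (M *\<^sub>v v) \<le> spectral_norm M * l2_vec_norm v"
proof (cases "l2_vec_norm v = 0")
  case True
  then have "v = 0\<^sub>v (dim_col M)" using l2_eq_0 assms by metis
  then have "M *\<^sub>v v = 0\<^sub>v (dim_row M)" by (intro eq_vecI) auto
  then show ?thesis by (simp add: True)
next
  case False
  define a where "a = complex_of_real (inverse (l2_vec_norm v))"
  have pos: "l2_vec_norm v > 0" using False l2_nonneg[of v] by linarith
  have "l2_vec_norm (M *\<^sub>v (a \<cdot>\<^sub>v v)) \<le> spectral_norm M"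
    unfolding spectral_norm_def
    by (rule cSUP_upper[OF _ spectral_bdd])
      (use assms pos in \<open>auto simp: l2_smult a_def norm_divide norm_inverse intro!: carrier_vecI\<close>)
  moreover have "M *\<^sub>v (a \<cdot>\<^sub>v v) = a \<cdot>\<^sub>v (M *\<^sub>v v)"
    using assms by (intro mult_mat_vec[of _ "dim_row M" "dim_col M"]) (auto intro!: carrier_vecI)
  ultimately show ?thesis
    using pos by (simp add: l2_smult a_def norm_divide field_simps)
qed

lemma spectral_least:
  assumes "C \<ge> 0" "\<And>v. dim_vec v = dim_col M \<Longrightarrow> l2_vec_norm (M *\<^sub>v v) \<le> C * l2_vec_norm v"
  shows "spectral_norm M \<le> C"
  unfolding spectral_norm_def
proof (rule cSUP_least)
  show "{v \<in> carrier_vec (dim_col M). l2_vec_norm v \<le> 1} \<noteq> {}"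
    by (auto intro!: exI[of _ "0\<^sub>v (dim_col M)"])
next
  fix v assume v: "v \<in> {v \<in> carrier_vec (dim_col M). l2_vec_norm v \<le> 1}"
  then have "l2_vec_norm (M *\<^sub>v v) \<le> C * l2_vec_norm v" by (intro assms) auto
  also have "\<dots> \<le> C * 1" using v assms(1) by (intro mult_mono) auto
  finally show "l2_vec_norm (M *\<^sub>v v) \<le> C" by simp
qed

lemma spectral_mult:
  assumes "dim_col M = dim_row N"
  shows "spectral_norm (M * N) \<le> spectral_norm M * spectral_norm N"
proof (rule spectral_least)
  fix v :: "complex vec" assume v: "dim_vec v = dim_col (M * N)"
  have "l2_vec_norm (M * N *\<^sub>v v) = l2_vec_norm (M *\<^sub>v (N *\<^sub>v v))"
    using assms v by (simp add: mult_mult_vec_dim)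
  also have "\<dots> \<le> spectral_norm M * l2_vec_norm (N *\<^sub>v v)"
    using assms by (intro spectral_bound) auto
  also have "\<dots> \<le> spectral_norm M * (spectral_norm N * l2_vec_norm v)"
    using v by (intro mult_left_mono spectral_bound) auto
  finally show "l2_vec_norm (M * N *\<^sub>v v) \<le> spectral_norm M * spectral_norm N * l2_vec_norm v"
    by (simp add: mult.assoc)
qed simp

lemma spectral_add:
  assumes "dim_row M = dim_row N" "dim_col M = dim_col N"
  shows "spectral_norm (M + N) \<le> spectral_norm M + spectral_norm N"
proof (rule spectral_least)
  fix v :: "complex vec" assume v: "dim_vec v = dim_col (M + N)"
  have "l2_vec_norm ((M + N) *\<^sub>v v) \<le> l2_vec_norm (M *\<^sub>v v) + l2_vec_norm (N *\<^sub>v v)"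
    using assms v by (simp add: add_mult_vec_dim l2_triangle)
  also have "\<dots> \<le> spectral_norm M * l2_vec_norm v + spectral_norm N * l2_vec_norm v"
    using assms v by (intro add_mono spectral_bound) auto
  finally show "l2_vec_norm ((M + N) *\<^sub>v v) \<le> (spectral_norm M + spectral_norm N) * l2_vec_norm v"
    by (simp add: algebra_simps)
qed simp

lemma spectral_adjoint: "spectral_norm (mat_adjoint M) = spectral_norm M"
proof -
  have "spectral_norm (mat_adjoint M) \<le> spectral_norm M" for M
  proof (rule spectral_least)
    fix v :: "complex vec" assume v: "dim_vec v = dim_col (mat_adjoint M)"
    let ?u = "mat_adjoint M *\<^sub>v v"
    have "(l2_vec_norm ?u)\<^sup>2 = Re (?u \<bullet>c ?u)" by (simp add: l2_sq)
    also have "\<dots> = Re (v \<bullet>c (M *\<^sub>v ?u))" using v by (subst scalar_prod_adjoint) auto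
    also have "\<dots> \<le> l2_vec_norm v * l2_vec_norm (M *\<^sub>v ?u)"
      using v by (intro Re_scalar_prod_le) auto
    also have "\<dots> \<le> l2_vec_norm v * (spectral_norm M * l2_vec_norm ?u)"
      using v by (intro mult_left_mono spectral_bound) auto
    finally have "l2_vec_norm ?u * l2_vec_norm ?u \<le> (spectral_norm M * l2_vec_norm v) * l2_vec_norm ?u"
      by (simp add: power2_eq_square mult_ac)
    then show "l2_vec_norm ?u \<le> spectral_norm M * l2_vec_norm v"
      using l2_nonneg[of ?u] by (cases "l2_vec_norm ?u = 0") (auto simp: mult_le_cancel_right)
  qed simp
  from this[of M] this[of "mat_adjoint M"] show ?thesis by simp
qed

lemma spectral_one_le: "spectral_norm (1\<^sub>m k) \<le> 1"
  by (rule spectral_least) (auto intro!: carrier_vecI)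

text \<open>The quadratic form of \<open>hat m Z\<close> is the sum of the forms of \<open>Z\<close> on the \<open>m\<close> blocks of the vector.
  The bound is one-sided, so that it also transports Loewner inequalities.\<close>

lemma hat_quadratic_bound:
  assumes Z: "dim_row Z = k" "dim_col Z = k"
    and bound: "\<And>v. dim_vec v = k \<Longrightarrow> Re ((Z *\<^sub>v v) \<bullet>c v) \<le> C * (l2_vec_norm v)\<^sup>2"
  shows "dim_vec u = m * k \<Longrightarrow> Re ((hat m Z *\<^sub>v u) \<bullet>c u) \<le> C * (l2_vec_norm u)\<^sup>2"
proof (induction m arbitrary: u)
  case 0
  then show ?case by (simp add: scalar_prod_def l2_vec_norm_def)
next
  case (Suc m)
  define v where "v = vec_first u k"
  define w where "w = vec_last u (m * k)"
  have d: "dim_vec v = k" "dim_vec w = m * k"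
    using Suc.prems by (simp_all add: v_def w_def)
  have "u \<in> carrier_vec (k + m * k)" using Suc.prems by (intro carrier_vecI) simp
  then have u: "u = v @\<^sub>v w"
    using vec_first_last_append[of u k "m * k"] by (simp add: v_def w_def)
  have "(hat (Suc m) Z *\<^sub>v u) \<bullet>c u = (Z *\<^sub>v v) \<bullet>c v + (hat m Z *\<^sub>v w) \<bullet>c w"
  proof -
    have conj: "conjugate (v @\<^sub>v w) = conjugate v @\<^sub>v conjugate w"
      by (intro eq_vecI) auto
    have "hat (Suc m) Z *\<^sub>v (v @\<^sub>v w) = (Z *\<^sub>v v) @\<^sub>v (hat m Z *\<^sub>v w)"
      using d Z by (simp add: hat_Suc_mult_vec)
    then show ?thesis
      unfolding u conj by (simp, intro scalar_prod_append[of _ k _ "m * k"])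
        (use d Z in \<open>auto intro!: carrier_vecI\<close>)
  qed
  then show ?case
    using bound[OF d(1)] Suc.IH[OF d(2)] by (simp add: u l2_append algebra_simps)
qed

text \<open>The square of the spectral norm bounds the quadratic form of \<open>Z\<^sup>* Z\<close>, and \<open>hat\<close> commutes with this product.\<close>

lemma spectral_hat: "spectral_norm (hat m Z) \<le> spectral_norm Z"
proof (rule spectral_least)
  fix u :: "complex vec" assume u: "dim_vec u = dim_col (hat m Z)"
  let ?G = "mat_adjoint Z * Z" 
  have eq: "Re ((mat_adjoint M * M *\<^sub>v v) \<bullet>c v) = (l2_vec_norm (M *\<^sub>v v))\<^sup>2"
    if "dim_vec v = dim_col M" for M v
  proof -
    have "(mat_adjoint M * M *\<^sub>v v) \<bullet>c v = (M *\<^sub>v v) \<bullet>c (M *\<^sub>v v)"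
      using that scalar_prod_adjoint[of "M *\<^sub>v v" "mat_adjoint M" v] by (simp add: mult_mult_vec_dim)
    then show ?thesis by (simp only: l2_sq)
  qed
  have "Re ((hat m ?G *\<^sub>v u) \<bullet>c u) \<le> (spectral_norm Z)\<^sup>2 * (l2_vec_norm u)\<^sup>2"
  proof (rule hat_quadratic_bound[of _ "dim_col Z"])
    fix v :: "complex vec" assume "dim_vec v = dim_col Z"
    then show "Re ((?G *\<^sub>v v) \<bullet>c v) \<le> (spectral_norm Z)\<^sup>2 * (l2_vec_norm v)\<^sup>2"
      using spectral_bound[of v Z] by (simp add: eq flip: power_mult_distrib)
  qed (use u in auto)
  then have "(l2_vec_norm (hat m Z *\<^sub>v u))\<^sup>2 \<le> (spectral_norm Z * l2_vec_norm u)\<^sup>2"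
    using u eq[of u "hat m Z"] by (simp add: hat_mult hat_adjoint power_mult_distrib)
  then show "l2_vec_norm (hat m Z *\<^sub>v u) \<le> spectral_norm Z * l2_vec_norm u"
    by (rule power2_le_imp_le) simp
qed simp

lemma entry_le_spectral:
  assumes "i < dim_row M" "j < dim_col M"
  shows "cmod (M $$ (i, j)) \<le> spectral_norm M"
proof -
  have "l2_vec_norm (unit_vec (dim_col M) j) = 1"
  proof -
    have "(\<Sum>i<dim_col M. (cmod (unit_vec (dim_col M) j $ i))\<^sup>2) = (\<Sum>i<dim_col M. if i = j then 1 else 0)"
      by (intro sum.cong) (use assms in auto)
    then show ?thesis using assms by (simp add: l2_vec_norm_def)
  qed
  moreover have "cmod (M $$ (i, j)) = cmod ((M *\<^sub>v unit_vec (dim_col M) j) $ i)"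
    using assms by simp
  moreover have "\<dots> \<le> l2_vec_norm (M *\<^sub>v unit_vec (dim_col M) j)"
    unfolding l2_vec_norm_eq using assms
    by (intro member_le_L2_set[of _ _ "\<lambda>i. cmod ((M *\<^sub>v unit_vec (dim_col M) j) $ i)"]) auto
  ultimately show ?thesis using spectral_bound[of "unit_vec (dim_col M) j" M] by simp
qed

section \<open>Inverse matrices\<close>

lemma mat_inv_eqI:
  assumes A: "A \<in> carrier_mat n n" and B: "B \<in> carrier_mat n n" and AB: "A * B = 1\<^sub>m n"
  shows "mat_inv A = B" "invertible_mat A"
proof -
  have BA: "B * A = 1\<^sub>m n" by (rule mat_mult_left_right_inverse[OF A B AB])
  then show "invertible_mat A"
    using A B AB by (auto simp: invertible_mat_def inverts_mat_def)
  have "A \<in> Units (ring_mat TYPE(complex) n undefined)"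
    using A B AB BA by (auto simp: Units_def ring_mat_simps)
  then obtain C where C: "mat_inverse A = Some C"
    using mat_inverse(1)[OF A, of undefined] by (cases "mat_inverse A") auto
  have "C * A = 1\<^sub>m n" "C \<in> carrier_mat n n" using mat_inverse(2)[OF A C] by auto
  then have "C = C * (A * B)" using AB by simp
  also have "\<dots> = B" using \<open>C * A = 1\<^sub>m n\<close> \<open>C \<in> carrier_mat n n\<close> A B
    by (subst assoc_mult_mat[symmetric, of C n n A n B n]) auto
  finally show "mat_inv A = B" using C by (simp add: mat_inv_def)
qed

lemma mat_inv_invertible:
  assumes "A \<in> carrier_mat n n" "invertible_mat A"
  shows "mat_inv A \<in> carrier_mat n n" "A * mat_inv A = 1\<^sub>m n" "mat_inv A * A = 1\<^sub>m n"
proof -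
  obtain B where AB: "A * B = 1\<^sub>m (dim_row A)" and BA: "B * A = 1\<^sub>m (dim_row B)"
    using assms(2) by (auto simp: invertible_mat_def inverts_mat_def)
  from arg_cong[OF AB, of dim_col] arg_cong[OF BA, of dim_col] assms(1)
  have B: "B \<in> carrier_mat n n" by auto
  have "mat_inv A = B" using assms(1) B AB by (intro mat_inv_eqI[of A n]) auto
  then show "mat_inv A \<in> carrier_mat n n" "A * mat_inv A = 1\<^sub>m n" "mat_inv A * A = 1\<^sub>m n"
    using AB BA B assms(1) by auto
qed

lemma injective_imp_invertible:
  fixes A :: "complex mat"
  assumes A: "A \<in> carrier_mat n n"
    and inj: "\<And>v. dim_vec v = n \<Longrightarrow> A *\<^sub>v v = 0\<^sub>v n \<Longrightarrow> v = 0\<^sub>v n"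
  shows "invertible_mat A"
proof -
  have "det A \<noteq> 0"
    using det_0_iff_vec_prod_zero_field[OF A] inj by auto
  from det_non_zero_imp_unit[OF A this, of undefined]
  obtain B where "B \<in> carrier_mat n n" "A * B = 1\<^sub>m n"
    by (auto simp: Units_def ring_mat_simps)
  then show ?thesis using mat_inv_eqI(2)[OF A] by blast
qed

lemma mat_inv_hat:
  assumes "A \<in> carrier_mat n n" "invertible_mat A"
  shows "mat_inv (hat m A) = hat m (mat_inv A)"
proof (rule mat_inv_eqI)
  show "hat m A \<in> carrier_mat (m * n) (m * n)" "hat m (mat_inv A) \<in> carrier_mat (m * n) (m * n)"
    using assms mat_inv_invertible[OF assms] by (auto intro!: carrier_matI)
  show "hat m A * hat m (mat_inv A) = 1\<^sub>m (m * n)"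
    using assms mat_inv_invertible[OF assms] by (simp flip: hat_mult)
qed

lemma mat_inv_hermitian:
  assumes "hermitian_mat n A" "invertible_mat A"
  shows "mat_adjoint (mat_inv A) = mat_inv A"
proof -
  have A: "A \<in> carrier_mat n n" "mat_adjoint A = A" using assms(1) by (auto simp: hermitian_mat_def)
  note inv = mat_inv_invertible[OF A(1) assms(2)]
  have "A * mat_adjoint (mat_inv A) = mat_adjoint (mat_inv A * A)"
    using inv(1) A by (simp add: adjoint_mult)
  then have "A * mat_adjoint (mat_inv A) = 1\<^sub>m n" using inv(3) by simp
  then show ?thesis using inv(1) A by (intro mat_inv_eqI(1)[OF A(1), symmetric]) auto
qed

lemma pos_def_invertible:
  assumes "pos_def_mat n A"
  shows "invertible_mat A"
proof (rule injective_imp_invertible)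
  show "A \<in> carrier_mat n n" using assms by (simp add: pos_def_mat_def hermitian_mat_def)
  fix v :: "complex vec" assume v: "dim_vec v = n" "A *\<^sub>v v = 0\<^sub>v n"
  show "v = 0\<^sub>v n"
  proof (rule ccontr)
    assume "v \<noteq> 0\<^sub>v n"
    then have "0 < Re ((A *\<^sub>v v) \<bullet>c v)"
      using assms v by (auto simp: pos_def_mat_def intro: carrier_vecI)
    with v show False by (simp add: scalar_prod_def)
  qed
qed

section \<open>Neumann series estimates\<close>

lemma l2_uminus [simp]: "l2_vec_norm (- v) = l2_vec_norm v"
  by (simp add: l2_vec_norm_def)

lemma l2_diff:
  assumes "dim_vec u = dim_vec v"
  shows "(l2_vec_norm (u - v))\<^sup>2 = (l2_vec_norm u)\<^sup>2 - 2 * Re (u \<bullet>c v) + (l2_vec_norm v)\<^sup>2"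
proof -
  have eq: "(cmod (x - y))\<^sup>2 = (cmod x)\<^sup>2 - 2 * Re (x * cnj y) + (cmod y)\<^sup>2" for x y
    unfolding cmod_power2 by (simp add: power2_eq_square algebra_simps)
  have "(l2_vec_norm (u - v))\<^sup>2 = (\<Sum>i<dim_vec v. (cmod (u $ i - v $ i))\<^sup>2)"
    by (simp add: l2_vec_norm_def sum_nonneg)
  also have "\<dots> = (\<Sum>i<dim_vec v. (cmod (u $ i))\<^sup>2 - 2 * Re (u $ i * cnj (v $ i)) + (cmod (v $ i))\<^sup>2)"
    by (simp only: eq)
  also have "\<dots> = (l2_vec_norm u)\<^sup>2 - 2 * Re (u \<bullet>c v) + (l2_vec_norm v)\<^sup>2"
    using assms
    by (simp add: l2_vec_norm_def sum_nonneg sum.distrib sum_subtractf scalar_prod_def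
        atLeast0LessThan sum_distrib_left)
  finally show ?thesis .
qed

lemma one_plus_lower:
  assumes M: "dim_row M = n" "dim_col M = n" and v: "dim_vec v = n"
  shows "(1 - spectral_norm M) * l2_vec_norm v \<le> l2_vec_norm ((1\<^sub>m n + M) *\<^sub>v v)"
proof -
  let ?w = "(1\<^sub>m n + M) *\<^sub>v v"
  have w: "?w = v + M *\<^sub>v v" using M v by (simp add: add_mult_vec_dim one_mult_vec_dim)
  have "v = ?w + - (M *\<^sub>v v)" unfolding w using M v by (intro eq_vecI) auto
  then have "l2_vec_norm v \<le> l2_vec_norm ?w + l2_vec_norm (M *\<^sub>v v)"
    using l2_triangle[of ?w "- (M *\<^sub>v v)"] M by simp
  also have "l2_vec_norm (M *\<^sub>v v) \<le> spectral_norm M * l2_vec_norm v"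
    using M v by (intro spectral_bound) auto
  finally show ?thesis by (simp add: algebra_simps)
qed

text \<open>The lower bound \<open>\<parallel>(I + M) v\<parallel> \<ge> (1 - \<parallel>M\<parallel>) \<parallel>v\<parallel>\<close> gives injectivity, hence invertibility, and at the
  same time the norm of the inverse; the Neumann series itself is not summed.\<close>

lemma one_plus_invertible:
  assumes M: "M \<in> carrier_mat n n" and small: "spectral_norm M \<le> a" "a < 1"
  obtains N where "N \<in> carrier_mat n n" "(1\<^sub>m n + M) * N = 1\<^sub>m n" "N * (1\<^sub>m n + M) = 1\<^sub>m n"
    "spectral_norm N \<le> 1 / (1 - a)"
proof
  let ?A = "1\<^sub>m n + M"
  have A: "?A \<in> carrier_mat n n" using M by auto
  have low: "(1 - a) * l2_vec_norm v \<le> l2_vec_norm (?A *\<^sub>v v)" if "dim_vec v = n" for v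
  proof -
    have "(1 - a) * l2_vec_norm v \<le> (1 - spectral_norm M) * l2_vec_norm v"
      using small by (intro mult_right_mono) auto
    then show ?thesis using one_plus_lower[of M n v] M that by auto
  qed
  have inv: "invertible_mat ?A"
  proof (rule injective_imp_invertible[OF A])
    fix v :: "complex vec" assume v: "dim_vec v = n" "?A *\<^sub>v v = 0\<^sub>v n"
    then have "l2_vec_norm v \<le> 0" using low[of v] small by (simp add: mult_le_0_iff)
    then have "l2_vec_norm v = 0" using l2_nonneg[of v] by linarith
    then show "v = 0\<^sub>v n" using l2_eq_0[of v] v by simp
  qed
  note * = mat_inv_invertible[OF A inv]
  show "mat_inv ?A \<in> carrier_mat n n" "?A * mat_inv ?A = 1\<^sub>m n" "mat_inv ?A * ?A = 1\<^sub>m n"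
    by (fact *)+
  show "spectral_norm (mat_inv ?A) \<le> 1 / (1 - a)"
  proof (rule spectral_least)
    fix v :: "complex vec" assume v: "dim_vec v = dim_col (mat_inv ?A)"
    let ?u = "mat_inv ?A *\<^sub>v v"
    have dv: "dim_vec v = n" using v * by simp
    have "?A *\<^sub>v ?u = ?A * mat_inv ?A *\<^sub>v v"
      using *(1) M dv by (simp add: mult_mult_vec_dim)
    also have "\<dots> = v" using *(2) dv by (simp add: one_mult_vec_dim)
    finally have "?A *\<^sub>v ?u = v" .
    then show "l2_vec_norm ?u \<le> 1 / (1 - a) * l2_vec_norm v"
      using low[of ?u] * small by (simp add: field_simps)
  qed (use small in simp)
qed

lemma spectral_smult: "spectral_norm (a \<cdot>\<^sub>m M) \<le> cmod a * spectral_norm M"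
proof (rule spectral_least)
  fix v :: "complex vec" assume v: "dim_vec v = dim_col (a \<cdot>\<^sub>m M)"
  have "(a \<cdot>\<^sub>m M) *\<^sub>v v = a \<cdot>\<^sub>v (M *\<^sub>v v)"
    using v by (intro eq_vecI) auto
  then show "l2_vec_norm ((a \<cdot>\<^sub>m M) *\<^sub>v v) \<le> cmod a * spectral_norm M * l2_vec_norm v"
    using spectral_bound[of v M] v by (simp add: l2_smult mult.assoc mult_left_mono)
qed simp

section \<open>Unitarily invariant norms\<close>

context
  fixes \<nu> :: "complex mat \<Rightarrow> real"
  assumes \<nu>: "unitarily_invariant_norm \<nu>"
begin

lemma uin_nonneg: "0 \<le> \<nu> Z"
  using \<nu> unfolding unitarily_invariant_norm_def by (metis carrier_matI)

lemma uin_zero: "\<nu> (0\<^sub>m r c) = 0"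
  using \<nu> unfolding unitarily_invariant_norm_def by (metis zero_carrier_mat)

lemma uin_smult: "\<nu> (a \<cdot>\<^sub>m Z) = cmod a * \<nu> Z"
  using \<nu> unfolding unitarily_invariant_norm_def by blast

lemma uin_add: "dim_row Y = dim_row Z \<Longrightarrow> dim_col Y = dim_col Z \<Longrightarrow> \<nu> (Y + Z) \<le> \<nu> Y + \<nu> Z"
  using \<nu> unfolding unitarily_invariant_norm_def by (metis carrier_matI)

lemma uin_minus:
  assumes "dim_row Y = dim_row Z" "dim_col Y = dim_col Z"
  shows "\<nu> (Y - Z) \<le> \<nu> Y + \<nu> Z"
proof -
  have "Y - Z = Y + (-1) \<cdot>\<^sub>m Z" using assms by (intro eq_matI) auto
  then show ?thesis using uin_add[of Y "(-1) \<cdot>\<^sub>m Z"] assms uin_smult[of "-1" Z] by simp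
qed

lemma spectral_le_uin: "spectral_norm Z \<le> \<nu> Z"
  using \<nu> unfolding unitarily_invariant_norm_def by blast

lemma uin_mult3:
  assumes "dim_col X = dim_row Y" "dim_col Y = dim_row Z"
  shows "\<nu> (X * Y * Z) \<le> spectral_norm X * \<nu> Y * spectral_norm Z"
  using \<nu> assms unfolding unitarily_invariant_norm_def by (metis carrier_matI)

lemma uin_mult_left:
  assumes "dim_col X = dim_row Y"
  shows "\<nu> (X * Y) \<le> spectral_norm X * \<nu> Y"
proof -
  have "\<nu> (X * Y) \<le> spectral_norm X * \<nu> Y * spectral_norm (1\<^sub>m (dim_col Y))"
    using uin_mult3[of X Y "1\<^sub>m (dim_col Y)"] assms by (simp add: one_mult_dim)
  also have "\<dots> \<le> spectral_norm X * \<nu> Y * 1"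
    by (intro mult_left_mono spectral_one_le mult_nonneg_nonneg uin_nonneg) simp
  finally show ?thesis by simp
qed

text \<open>Together with \<open>spectral_le_uin\<close>: the two norms are equivalent. This lets \<open>\<nu>\<close> pass to limits taken in the spectral
  norm.\<close>

lemma uin_le_spectral: "\<nu> Z \<le> spectral_norm Z * \<nu> (1\<^sub>m (dim_col Z))"
  using uin_mult_left[of Z "1\<^sub>m (dim_col Z)"] by (simp add: one_mult_dim)

end

section \<open>Invariance of the norm under the adjoint\<close>

text \<open>For a contraction, \<open>\<parallel>v - V\<^sup>* V v\<parallel>\<^sup>2 = \<parallel>v\<parallel>\<^sup>2 - 2 \<parallel>V v\<parallel>\<^sup>2 + \<parallel>V\<^sup>* V v\<parallel>\<^sup>2 \<le> \<parallel>v\<parallel>\<^sup>2 - \<parallel>V v\<parallel>\<^sup>2\<close>, and the left inverse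
  bounds \<open>\<parallel>V v\<parallel>\<close> below by a multiple of \<open>\<parallel>v\<parallel>\<close>. This is the starting condition of the
  Newton-Schulz iteration.\<close>

lemma contraction_defect_less_one:
  assumes V: "V \<in> carrier_mat n n" and L: "L \<in> carrier_mat n n" "L * V = 1\<^sub>m n"
    and contr: "spectral_norm V \<le> 1"
  shows "spectral_norm (1\<^sub>m n - mat_adjoint V * V) < 1"
proof -
  \<comment> \<open>The summand \<open>1\<close> keeps \<open>C \<ge> 1\<close>, so that \<open>1 - 1 / C\<close> is nonnegative and below \<open>1\<close>.\<close>
  define C where "C = 1 + (spectral_norm L)\<^sup>2"
  have C: "C \<ge> 1" by (simp add: C_def)
  have "spectral_norm (1\<^sub>m n - mat_adjoint V * V) \<le> sqrt (1 - 1 / C)"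
  proof (rule spectral_least)
    fix v :: "complex vec" assume "dim_vec v = dim_col (1\<^sub>m n - mat_adjoint V * V)"
    then have v: "dim_vec v = n" using V by simp
    let ?w = "mat_adjoint V *\<^sub>v (V *\<^sub>v v)"
    have w: "(1\<^sub>m n - mat_adjoint V * V) *\<^sub>v v = v - ?w"
      using V v by (simp add: minus_mult_vec_dim mult_mult_vec_dim one_mult_vec_dim)
    have "l2_vec_norm v = l2_vec_norm (L *\<^sub>v (V *\<^sub>v v))"
      using V L v by (simp flip: mult_mult_vec_dim add: one_mult_vec_dim)
    also have "\<dots> \<le> spectral_norm L * l2_vec_norm (V *\<^sub>v v)"
      using V L by (intro spectral_bound) auto
    finally have "(l2_vec_norm v)\<^sup>2 \<le> (spectral_norm L * l2_vec_norm (V *\<^sub>v v))\<^sup>2"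
      by (simp add: power_mono)
    also have "\<dots> \<le> C * (l2_vec_norm (V *\<^sub>v v))\<^sup>2"
      by (simp add: C_def power_mult_distrib mult_right_mono)
    finally have low: "(l2_vec_norm v)\<^sup>2 / C \<le> (l2_vec_norm (V *\<^sub>v v))\<^sup>2"
      using C by (simp add: field_simps)
    have "l2_vec_norm ?w \<le> spectral_norm V * l2_vec_norm (V *\<^sub>v v)"
      using spectral_bound[of "V *\<^sub>v v" "mat_adjoint V"] by (simp add: spectral_adjoint)
    also have "\<dots> \<le> 1 * l2_vec_norm (V *\<^sub>v v)" by (intro mult_right_mono contr) simp
    finally have wV: "(l2_vec_norm ?w)\<^sup>2 \<le> (l2_vec_norm (V *\<^sub>v v))\<^sup>2" by (simp add: power_mono)
    have "Re (v \<bullet>c ?w) = (l2_vec_norm (V *\<^sub>v v))\<^sup>2"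
      using V v by (simp flip: scalar_prod_adjoint add: l2_sq)
    then have "(l2_vec_norm (v - ?w))\<^sup>2 \<le> (l2_vec_norm v)\<^sup>2 - (l2_vec_norm (V *\<^sub>v v))\<^sup>2"
      using l2_diff[of v ?w] V v wV by simp
    also have "\<dots> \<le> (1 - 1 / C) * (l2_vec_norm v)\<^sup>2"
      using low by (simp add: algebra_simps)
    finally have "(l2_vec_norm (v - ?w))\<^sup>2 \<le> (sqrt (1 - 1 / C) * l2_vec_norm v)\<^sup>2"
      using C by (simp add: power_mult_distrib)
    then show "l2_vec_norm ((1\<^sub>m n - mat_adjoint V * V) *\<^sub>v v) \<le> sqrt (1 - 1 / C) * l2_vec_norm v"
      unfolding w by (rule power2_le_imp_le) (use C in simp)
  qed (use C in simp)
  also have "\<dots> < 1" using C by (simp add: field_simps)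
  finally show ?thesis .
qed

text \<open>The unitary factor \<open>U\<close> of a polar decomposition \<open>M = U |M|\<close> makes \<open>M U\<^sup>*\<close> and \<open>M\<^sup>* U\<close> Hermitian. These
  two linear conditions are kept by every step of the iteration, while \<open>V\<^sup>* V = I\<close> is reached only in
  the limit.\<close>

definition polar_approx :: "nat \<Rightarrow> complex mat \<Rightarrow> complex mat \<Rightarrow> bool" where
  "polar_approx n M V \<longleftrightarrow> V \<in> carrier_mat n n \<and>
     M * mat_adjoint V = V * mat_adjoint M \<and> mat_adjoint M * V = mat_adjoint V * M"

text \<open>With \<open>T = I - V\<^sup>* V\<close> the new matrix is \<open>V (I + T/2)\<close>; its defect is \<open>T\<^sup>2 (3 I + T) / 4\<close>, so the defect
  is squared up to a factor of norm at most \<open>1\<close>.\<close>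

lemma newton_schulz_step:
  assumes M: "M \<in> carrier_mat n n" and V: "polar_approx n M V"
    and r: "spectral_norm (1\<^sub>m n - mat_adjoint V * V) \<le> r" "r \<le> 1"
  obtains V' where "polar_approx n M V'" "spectral_norm (1\<^sub>m n - mat_adjoint V' * V') \<le> r * r"
proof
  define T where "T = 1\<^sub>m n - mat_adjoint V * V"
  define S where "S = 1\<^sub>m n + (1/2) \<cdot>\<^sub>m T"
  have dims [simp]: "dim_row M = n" "dim_col M = n" "dim_row V = n" "dim_col V = n"
    "dim_row T = n" "dim_col T = n" "dim_row S = n" "dim_col S = n"
    using M V by (auto simp: polar_approx_def T_def S_def)
  have inv: "M * mat_adjoint V = V * mat_adjoint M" "mat_adjoint M * V = mat_adjoint V * M"
    using V by (auto simp: polar_approx_def)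
  have S: "S = (3/2) \<cdot>\<^sub>m 1\<^sub>m n - (1/2) \<cdot>\<^sub>m (mat_adjoint V * V)"
    unfolding S_def T_def by (rule eq_matI) (auto simp: field_simps simp del: index_mult_mat(1))
  have Sadj: "mat_adjoint S = S"
    unfolding S by (simp add: mat_dim_algebra)
  have T: "mat_adjoint V * V = 1\<^sub>m n - T"
    unfolding T_def by (rule eq_matI) (auto simp del: index_mult_mat(1))
  \<comment> \<open>Here and in the next step the Hermitian products \<open>M V\<^sup>*\<close> and \<open>M\<^sup>* V\<close> are turned over one at a time until
    \<open>M\<close> has moved to the other end.\<close>
  have M1: "V * (mat_adjoint V * (V * mat_adjoint M)) = M * (mat_adjoint V * (V * mat_adjoint V))"
  proof -
    have "V * (mat_adjoint V * (V * mat_adjoint M)) = V * (mat_adjoint V * M) * mat_adjoint V"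
      by (simp add: mult_assoc_dim flip: inv(1))
    also have "\<dots> = (V * mat_adjoint M) * (V * mat_adjoint V)"
      by (simp add: mult_assoc_dim flip: inv(2))
    also have "\<dots> = M * (mat_adjoint V * (V * mat_adjoint V))"
      by (simp add: mult_assoc_dim flip: inv(1))
    finally show ?thesis .
  qed
  have M2: "mat_adjoint M * (V * (mat_adjoint V * V)) = mat_adjoint V * (V * (mat_adjoint V * M))"
  proof -
    have "mat_adjoint M * (V * (mat_adjoint V * V)) = (mat_adjoint M * V) * (mat_adjoint V * V)"
      by (simp add: mult_assoc_dim)
    also have "\<dots> = mat_adjoint V * (M * mat_adjoint V) * V"
      unfolding inv(2) by (simp add: mult_assoc_dim)
    also have "\<dots> = mat_adjoint V * V * (mat_adjoint M * V)"
      unfolding inv(1) by (simp add: mult_assoc_dim)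
    also have "\<dots> = mat_adjoint V * (V * (mat_adjoint V * M))"
      unfolding inv(2) by (simp add: mult_assoc_dim)
    finally show ?thesis .
  qed
  show "polar_approx n M (V * S)"
    unfolding polar_approx_def
  proof (intro conjI)
    show "V * S \<in> carrier_mat n n" by (auto intro!: carrier_matI)
    show "M * mat_adjoint (V * S) = V * S * mat_adjoint M"
      using M1 inv(1) by (simp add: adjoint_mult Sadj) (simp add: S mat_dim_algebra)
    show "mat_adjoint M * (V * S) = mat_adjoint (V * S) * M"
      using M2 inv(2) by (simp add: adjoint_mult Sadj) (simp add: S mat_dim_algebra)
  qed
  have "mat_adjoint (V * S) * (V * S) = S * (mat_adjoint V * V) * S"
    by (simp add: adjoint_mult Sadj mult_assoc_dim)
  then have "1\<^sub>m n - mat_adjoint (V * S) * (V * S) = 1\<^sub>m n - S * (1\<^sub>m n - T) * S"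
    unfolding T by simp
  also have "\<dots> = T * T * ((3/4) \<cdot>\<^sub>m 1\<^sub>m n + (1/4) \<cdot>\<^sub>m T)"
    unfolding S_def
    by (rule eq_matI) (simp_all add: mat_dim_algebra algebra_simps del: index_mult_mat(1))
  finally have T': "1\<^sub>m n - mat_adjoint (V * S) * (V * S) = T * T * ((3/4) \<cdot>\<^sub>m 1\<^sub>m n + (1/4) \<cdot>\<^sub>m T)" .
  have Tr: "spectral_norm T \<le> r" using r by (simp add: T_def)
  then have r0: "0 \<le> r" using spectral_nonneg[of T] by linarith
  have "spectral_norm ((3/4) \<cdot>\<^sub>m 1\<^sub>m n + (1/4) \<cdot>\<^sub>m T) \<le> cmod (3/4) * spectral_norm (1\<^sub>m n) + cmod (1/4) * spectral_norm T"
    by (rule order.trans[OF spectral_add]) (use spectral_smult[of "3/4" "1\<^sub>m n"] spectral_smult[of "1/4" T] in auto)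
  also have "\<dots> \<le> 3/4 * 1 + 1/4 * 1"
    using spectral_one_le[of n] Tr r by (intro add_mono mult_mono) auto
  finally have one: "spectral_norm ((3/4) \<cdot>\<^sub>m 1\<^sub>m n + (1/4) \<cdot>\<^sub>m T) \<le> 1" by simp
  have "spectral_norm (1\<^sub>m n - mat_adjoint (V * S) * (V * S))
      \<le> spectral_norm (T * T) * spectral_norm ((3/4) \<cdot>\<^sub>m 1\<^sub>m n + (1/4) \<cdot>\<^sub>m T)"
    unfolding T' by (rule spectral_mult) simp
  also have "\<dots> \<le> (spectral_norm T * spectral_norm T) * 1"
    by (intro mult_mono spectral_mult one) auto
  also have "\<dots> \<le> r * r" using Tr r0 by (simp add: mult_mono)
  finally show "spectral_norm (1\<^sub>m n - mat_adjoint (V * S) * (V * S)) \<le> r * r" .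
qed

text \<open>The iteration starts from \<open>M\<close> scaled to a contraction, whose defect has norm below \<open>1\<close> because \<open>M\<close>
  is invertible.\<close>

lemma polar_approx_exists:
  assumes M: "M \<in> carrier_mat n n" and inv: "invertible_mat M" and e: "0 < e"
  obtains V where "polar_approx n M V" "spectral_norm (1\<^sub>m n - mat_adjoint V * V) \<le> e"
proof -
  define a where "a = 1 / (1 + spectral_norm M)"
  have a: "0 < a" "a * spectral_norm M \<le> 1"
    using spectral_nonneg[of M] by (simp_all add: a_def field_simps add_pos_nonneg)
  define V0 where "V0 = complex_of_real a \<cdot>\<^sub>m M"
  define r where "r = spectral_norm (1\<^sub>m n - mat_adjoint V0 * V0)"
  note Mi = mat_inv_invertible[OF M inv]
  have V0: "polar_approx n M V0"
    using M by (auto simp: polar_approx_def V0_def mat_dim_algebra)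
  have "r < 1"
    unfolding r_def
  proof (rule contraction_defect_less_one)
    show "V0 \<in> carrier_mat n n" "complex_of_real (1 / a) \<cdot>\<^sub>m mat_inv M \<in> carrier_mat n n"
      using M Mi by (auto simp: V0_def)
    show "complex_of_real (1 / a) \<cdot>\<^sub>m mat_inv M * V0 = 1\<^sub>m n"
      using M Mi a by (simp add: V0_def smult_mult_dim) (rule eq_matI, auto)
    show "spectral_norm V0 \<le> 1"
      using spectral_smult[of "complex_of_real a" M] a by (simp add: V0_def)
  qed
  have r0: "0 \<le> r" by (simp add: r_def)
  have iter: "\<exists>V. polar_approx n M V \<and> spectral_norm (1\<^sub>m n - mat_adjoint V * V) \<le> r ^ Suc k" for k
  proof (induction k)
    case 0
    show ?case using V0 r_def by (intro exI[of _ V0]) auto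
  next
    case (Suc k)
    then obtain V where V: "polar_approx n M V" "spectral_norm (1\<^sub>m n - mat_adjoint V * V) \<le> r ^ Suc k"
      by blast
    have "r ^ Suc k \<le> 1" using r0 \<open>r < 1\<close> by (intro power_le_one) auto
    from newton_schulz_step[OF M V this] obtain V' where
      V': "polar_approx n M V'" "spectral_norm (1\<^sub>m n - mat_adjoint V' * V') \<le> r ^ Suc k * r ^ Suc k" .
    have "r ^ Suc k * r ^ Suc k = r ^ (Suc k + Suc k)" by (simp add: power_add)
    also have "\<dots> \<le> r ^ Suc (Suc k)" using r0 \<open>r < 1\<close> by (intro power_decreasing) auto
    finally show ?case using V' by (intro exI[of _ V']) auto
  qed
  obtain k where "r ^ k < e" using real_arch_pow_inv[OF e \<open>r < 1\<close>] by blast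
  moreover have "r ^ Suc k \<le> r ^ k" using r0 \<open>r < 1\<close> by (intro power_decreasing) auto
  ultimately show ?thesis using iter[of k] that by fastforce
qed

text \<open>If \<open>V\<close> were the exact polar factor, then \<open>V\<^sup>* M V\<^sup>* = V\<^sup>* V M\<^sup>* = M\<^sup>*\<close> with \<open>\<parallel>V\<parallel> = 1\<close>, and
  \<open>\<nu> (M\<^sup>*) \<le> \<nu> M\<close> would follow from the mixed submultiplicativity of \<open>\<nu>\<close>. An approximate factor costs an
  arbitrarily small error in both places.\<close>

lemma uin_adjoint_invertible:
  assumes \<nu>: "unitarily_invariant_norm \<nu>" and M: "M \<in> carrier_mat n n" and inv: "invertible_mat M"
  shows "\<nu> (mat_adjoint M) \<le> \<nu> M"
proof (rule field_le_epsilon)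
  fix e :: real assume e: "0 < e"
  \<comment> \<open>The total error for defect \<open>d\<close> is \<open>d (\<nu> M + \<parallel>M\<parallel> \<nu> I)\<close>; the summand \<open>1\<close> keeps \<open>c\<close> positive.\<close>
  define c where "c = 1 + \<nu> M + spectral_norm M * \<nu> (1\<^sub>m n)"
  have c: "0 < c" using uin_nonneg[OF \<nu>] by (simp add: c_def add_pos_nonneg)
  define d where "d = e / c"
  have d: "0 < d" using e c by (simp add: d_def)
  from polar_approx_exists[OF M inv d] obtain V where
    V: "polar_approx n M V" and Vd: "spectral_norm (1\<^sub>m n - mat_adjoint V * V) \<le> d" .
  define T where "T = 1\<^sub>m n - mat_adjoint V * V"
  have dims [simp]: "dim_row M = n" "dim_col M = n" "dim_row V = n" "dim_col V = n"
    "dim_row T = n" "dim_col T = n"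
    using M V by (auto simp: polar_approx_def T_def)
  have Td: "spectral_norm T \<le> d" using Vd by (simp add: T_def)
  have normV: "spectral_norm V \<le> sqrt (1 + d)"
  proof (rule spectral_least)
    fix v :: "complex vec" assume v: "dim_vec v = dim_col V"
    have "(l2_vec_norm (V *\<^sub>v v))\<^sup>2 = Re (v \<bullet>c (mat_adjoint V *\<^sub>v (V *\<^sub>v v)))"
      using v by (simp flip: scalar_prod_adjoint add: l2_sq)
    also have "mat_adjoint V *\<^sub>v (V *\<^sub>v v) = v - T *\<^sub>v v"
      unfolding T_def using v by (simp add: minus_mult_vec_dim mult_mult_vec_dim one_mult_vec_dim)
        (intro eq_vecI, auto)
    also have "Re (v \<bullet>c (v - T *\<^sub>v v)) \<le> l2_vec_norm v * l2_vec_norm (v - T *\<^sub>v v)"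
      using v by (intro Re_scalar_prod_le) auto
    also have "\<dots> \<le> l2_vec_norm v * ((1 + d) * l2_vec_norm v)"
    proof (rule mult_left_mono)
      have "v - T *\<^sub>v v = v + - (T *\<^sub>v v)" using v by (intro eq_vecI) auto
      then have "l2_vec_norm (v - T *\<^sub>v v) \<le> l2_vec_norm v + l2_vec_norm (T *\<^sub>v v)"
        using l2_triangle[of v "- (T *\<^sub>v v)"] v by simp
      also have "\<dots> \<le> l2_vec_norm v + d * l2_vec_norm v"
        using spectral_bound[of v T] mult_right_mono[OF Td l2_nonneg[of v]] v by simp
      finally show "l2_vec_norm (v - T *\<^sub>v v) \<le> (1 + d) * l2_vec_norm v"
        by (simp add: algebra_simps)
    qed simp
    finally have "(l2_vec_norm (V *\<^sub>v v))\<^sup>2 \<le> (1 + d) * (l2_vec_norm v)\<^sup>2"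
      by (simp add: power2_eq_square mult_ac)
    then have "(l2_vec_norm (V *\<^sub>v v))\<^sup>2 \<le> (sqrt (1 + d) * l2_vec_norm v)\<^sup>2"
      using d by (simp add: power_mult_distrib)
    then show "l2_vec_norm (V *\<^sub>v v) \<le> sqrt (1 + d) * l2_vec_norm v"
      by (rule power2_le_imp_le) (use d in simp)
  qed (use d in simp)
  have "mat_adjoint V * M * mat_adjoint V = mat_adjoint V * V * mat_adjoint M"
    using V by (simp add: polar_approx_def mult_assoc_dim)
  then have eq: "mat_adjoint M = mat_adjoint V * M * mat_adjoint V + T * mat_adjoint M"
    unfolding T_def by (simp add: minus_mult_dim one_mult_dim)
      (rule eq_matI, auto simp del: index_mult_mat(1))
  have "\<nu> (mat_adjoint M) \<le> \<nu> (mat_adjoint V * M * mat_adjoint V) + \<nu> (T * mat_adjoint M)"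
    by (subst eq, rule uin_add[OF \<nu>]) auto
  also have "\<nu> (mat_adjoint V * M * mat_adjoint V) \<le> spectral_norm V * \<nu> M * spectral_norm V"
    using uin_mult3[OF \<nu>, of "mat_adjoint V" M "mat_adjoint V"] by (simp add: spectral_adjoint)
  also have "\<dots> = \<nu> M * (spectral_norm V)\<^sup>2" by (simp add: power2_eq_square)
  also have "\<dots> \<le> \<nu> M * (sqrt (1 + d))\<^sup>2"
    using normV by (intro mult_left_mono power_mono uin_nonneg[OF \<nu>]) auto
  also have "\<nu> (T * mat_adjoint M) \<le> spectral_norm T * \<nu> (mat_adjoint M)"
    by (rule uin_mult_left[OF \<nu>]) simp
  also have "\<dots> \<le> d * (spectral_norm M * \<nu> (1\<^sub>m n))"
    using Td d uin_le_spectral[OF \<nu>, of "mat_adjoint M"]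
    by (intro mult_mono uin_nonneg[OF \<nu>]) (auto simp: spectral_adjoint)
  also have "\<nu> M * (sqrt (1 + d))\<^sup>2 + d * (spectral_norm M * \<nu> (1\<^sub>m n)) = \<nu> M + d * (c - 1)"
    using d by (simp add: c_def algebra_simps)
  also have "\<dots> \<le> \<nu> M + e" using d c by (simp add: d_def field_simps)
  finally show "\<nu> (mat_adjoint M) \<le> \<nu> M + e" by simp
qed

text \<open>Shifting \<open>M\<close> by a small multiple of the identity that avoids the finitely many eigenvalues makes it
  invertible, and changes \<open>\<nu> M\<close> and \<open>\<nu> (M\<^sup>*)\<close> by little.\<close>

lemma uin_adjoint:
  assumes \<nu>: "unitarily_invariant_norm \<nu>" and M: "M \<in> carrier_mat n n"
  shows "\<nu> (mat_adjoint M) \<le> \<nu> M"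
proof (rule field_le_epsilon)
  fix e :: real assume e: "0 < e"
  \<comment> \<open>A shift by less than \<open>d\<close> changes each of the two norms by at most \<open>d \<nu> I \<le> e/2\<close>.\<close>
  define d where "d = e / (2 * (1 + \<nu> (1\<^sub>m n)))"
  have d: "0 < d" using e uin_nonneg[OF \<nu>] by (simp add: d_def add_pos_nonneg)
  have "finite {x. poly (char_poly M) x = 0}"
    using degree_monic_char_poly[OF M] by (intro poly_roots_finite) auto
  then have "finite {t. poly (char_poly M) (complex_of_real t) = 0}"
    using finite_vimageI[of "{x. poly (char_poly M) x = 0}" complex_of_real] inj_of_real
    by (simp add: vimage_def)
  then have "\<exists>t\<in>{-d<..<0}. t \<notin> {t. poly (char_poly M) (complex_of_real t) = 0}"
    using infinite_Ioo[of "-d" 0] d by (metis finite_subset neg_less_0_iff_less subsetI)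
  then obtain t where t: "-d < t" "t < 0" "\<not> eigenvalue M (complex_of_real t)"
    using eigenvalue_root_char_poly[OF M] by auto
  define E where "E = complex_of_real t \<cdot>\<^sub>m 1\<^sub>m n"
  have dims [simp]: "dim_row M = n" "dim_col M = n" "dim_row E = n" "dim_col E = n"
    using M by (auto simp: E_def)
  have Eadj: "mat_adjoint E = E" by (simp add: E_def adjoint_smult)
  have \<nu>E: "\<nu> E \<le> d * \<nu> (1\<^sub>m n)"
    using t mult_right_mono[of "- t" d "\<nu> (1\<^sub>m n)"] uin_nonneg[OF \<nu>]
    by (simp add: E_def uin_smult[OF \<nu>])
  have carr: "M - E \<in> carrier_mat n n" by (auto intro!: carrier_matI)
  have "invertible_mat (M - E)"
  proof (rule injective_imp_invertible[OF carr])
    fix v :: "complex vec" assume v: "dim_vec v = n" "(M - E) *\<^sub>v v = 0\<^sub>v n"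
    have "E *\<^sub>v v = complex_of_real t \<cdot>\<^sub>v v"
      using v carrier_vecI[OF v(1)] unfolding E_def by (intro eq_vecI) auto
    then have "M *\<^sub>v v - complex_of_real t \<cdot>\<^sub>v v = 0\<^sub>v n"
      using v by (simp add: minus_mult_vec_dim)
    then have "(M *\<^sub>v v) $ i - (complex_of_real t \<cdot>\<^sub>v v) $ i = 0" if "i < n" for i
      using v that by (metis index_minus_vec(1) index_smult_vec(2) index_zero_vec(1))
    then have "M *\<^sub>v v = complex_of_real t \<cdot>\<^sub>v v" using v by (intro eq_vecI) auto
    then show "v = 0\<^sub>v n" using t(3) v carrier_vecI[OF v(1)] by (auto simp: eigenvalue_def eigenvector_def)
  qed
  note main = uin_adjoint_invertible[OF \<nu> carr this]
  have "mat_adjoint M = mat_adjoint (M - E) + E"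
    by (simp add: adjoint_minus Eadj) (rule eq_matI, auto)
  then have "\<nu> (mat_adjoint M) \<le> \<nu> (mat_adjoint (M - E)) + \<nu> E"
    using uin_add[OF \<nu>, of "mat_adjoint (M - E)" E] by simp
  also have "\<dots> \<le> \<nu> M + \<nu> E + \<nu> E"
    using main uin_minus[OF \<nu>, of M E] by simp
  also have "\<dots> \<le> \<nu> M + e"
  proof -
    have "2 * d * \<nu> (1\<^sub>m n) \<le> 2 * d * (1 + \<nu> (1\<^sub>m n))" using d by (intro mult_left_mono) auto
    also have "\<dots> = e" using uin_nonneg[OF \<nu>, of "1\<^sub>m n"] by (simp add: d_def field_simps)
    finally show ?thesis using \<nu>E by simp
  qed
  finally show "\<nu> (mat_adjoint M) \<le> \<nu> M + e" .
qed

section \<open>Uniqueness below a positive definite solution\<close>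

lemma spectral_norm_zero_entry:
  assumes "spectral_norm M \<le> 0" "i < dim_row M" "j < dim_col M"
  shows "M $$ (i, j) = 0"
  using order.trans[OF entry_le_spectral[OF assms(2,3)] assms(1)] by simp

text \<open>Polarisation between \<open>w\<close> and \<open>F w\<close> turns the vanishing form into \<open>\<parallel>F w\<parallel>\<^sup>2 = 0\<close>.\<close>

lemma hermitian_quadratic_zero:
  assumes F: "hermitian_mat n F" and zero: "\<And>v. dim_vec v = n \<Longrightarrow> Re ((F *\<^sub>v v) \<bullet>c v) = 0"
  shows "F = 0\<^sub>m n n"
proof -
  have dims [simp]: "dim_row F = n" "dim_col F = n" and adj: "mat_adjoint F = F"
    using F by (auto simp: hermitian_mat_def)
  have Fw: "l2_vec_norm (F *\<^sub>v w) = 0" if w: "dim_vec w = n" for w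
  proof -
    let ?u = "F *\<^sub>v w"
    have c: "w \<in> carrier_vec n" "?u \<in> carrier_vec n" "F *\<^sub>v ?u \<in> carrier_vec n"
      "F \<in> carrier_mat n n"
      using w by (auto intro!: carrier_vecI carrier_matI)
    have "(F *\<^sub>v (w + ?u)) \<bullet>c (w + ?u)
        = (F *\<^sub>v w) \<bullet>c w + (F *\<^sub>v w) \<bullet>c ?u + ((F *\<^sub>v ?u) \<bullet>c w + (F *\<^sub>v ?u) \<bullet>c ?u)"
      using w c
      by (simp add: mult_add_distrib_mat_vec[of F n n] conjugate_add_vec[of _ n] add_scalar_prod_distrib[of _ n]
          scalar_prod_add_distrib[of _ n])
    moreover have "(F *\<^sub>v ?u) \<bullet>c w = ?u \<bullet>c ?u"
      using scalar_prod_adjoint[of ?u F w] adj w by simp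
    ultimately have "2 * Re (?u \<bullet>c ?u) = 0"
      using zero[of "w + ?u"] zero[of w] zero[of ?u] w by simp
    then show ?thesis by (simp add: l2_sq)
  qed
  have "spectral_norm F \<le> 0" by (rule spectral_least) (use Fw in auto)
  then show ?thesis using spectral_norm_zero_entry[of F] by (intro eq_matI) auto
qed

text \<open>Put \<open>F = X - Y \<ge> 0\<close> and \<open>B = hat Y\<^sup>-\<^sup>1 A\<close>. The difference of the two equations is
  \<open>F = B\<^sup>* hat (Y - Y X\<^sup>-\<^sup>1 Y) B\<close>, and \<open>Y - Y X\<^sup>-\<^sup>1 Y = F - F X\<^sup>-\<^sup>1 F \<le> F\<close>. Thus a bound \<open>C\<close> for the form of \<open>F\<close>
  improves to \<open>C \<parallel>B\<parallel>\<^sup>2\<close>, again and again. Positivity of \<open>X\<close> enters through \<open>F X\<^sup>-\<^sup>1 F \<ge> 0\<close>.\<close>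

lemma loewner_ge_imp_eq:
  assumes X: "pos_def_mat n X" and solX: "hermitian_solution m n A Q X"
    and solY: "hermitian_solution m n A Q Y" and ge: "loewner_ge n X Y"
    and A: "A \<in> carrier_mat (m * n) n"
    and contr: "spectral_norm (hat m (mat_inv Y) * A) < 1"
  shows "X = Y"
proof -
  have hX: "hermitian_mat n X" and hY: "hermitian_mat n Y"
    and iX: "invertible_mat X" and iY: "invertible_mat Y"
    using solX solY by (auto simp: hermitian_solution_def)
  have cX: "X \<in> carrier_mat n n" and cY: "Y \<in> carrier_mat n n"
    and aX: "mat_adjoint X = X" and aY: "mat_adjoint Y = Y"
    using hX hY by (auto simp: hermitian_mat_def)
  define Xi where "Xi = mat_inv X"
  define Yi where "Yi = mat_inv Y"
  note IX = mat_inv_invertible[OF cX iX, folded Xi_def]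
    and IY = mat_inv_invertible[OF cY iY, folded Yi_def]
  have aYi: "mat_adjoint Yi = Yi" using mat_inv_hermitian[OF hY iY] by (simp add: Yi_def)
  have aXi: "mat_adjoint Xi = Xi" using mat_inv_hermitian[OF hX iX] by (simp add: Xi_def)
  define F where "F = X - Y"
  have F: "hermitian_mat n F"
    using cX cY aX aY by (auto simp: F_def hermitian_mat_def adjoint_minus)
  have psd: "0 \<le> Re ((F *\<^sub>v v) \<bullet>c v)" if "dim_vec v = n" for v
    using ge that by (auto simp: loewner_ge_def pos_semidef_mat_def F_def intro: carrier_vecI)
  have dims [simp]: "dim_row X = n" "dim_col X = n" "dim_row Y = n" "dim_col Y = n"
    "dim_row Xi = n" "dim_col Xi = n" "dim_row Yi = n" "dim_col Yi = n"
    "dim_row F = n" "dim_col F = n" "dim_row A = m * n" "dim_col A = n"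
    using cX cY IX IY A by (auto simp: F_def)
  define B where "B = hat m Yi * A"
  have dimB [simp]: "dim_row B = m * n" "dim_col B = n" by (auto simp: B_def)
  have A_eq: "A = hat m Y * B"
    using IY by (simp add: B_def one_mult_dim flip: mult_assoc_dim hat_mult)
  define G where "G = F - F * (Xi * F)"
  have G: "G = Y - Y * (Xi * Y)"
  proof -
    have "Xi * F = 1\<^sub>m n - Xi * Y" using IX by (simp add: F_def mult_minus_dim)
    moreover have "X * (Xi * Y) = Y" using IX by (simp add: one_mult_dim flip: mult_assoc_dim)
    ultimately have "F * (Xi * F) = X - Y - (Y - Y * (Xi * Y))"
      by (simp add: F_def mat_dim_algebra)
    then show ?thesis
      unfolding G_def F_def by simp (rule eq_matI, auto simp del: index_mult_mat(1))
  qed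
  have "X + mat_adjoint A * (hat m Xi * A) = Y + mat_adjoint A * (hat m Yi * A)"
    using solX solY mat_inv_hat[OF cX iX] mat_inv_hat[OF cY iY]
    by (simp add: hermitian_solution_def mult_assoc_dim flip: Xi_def Yi_def)
  then have eq: "(X + mat_adjoint A * (hat m Xi * A)) $$ (i, j)
      = (Y + mat_adjoint A * (hat m Yi * A)) $$ (i, j)" for i j by simp
  have "F = mat_adjoint A * (hat m Yi * A) - mat_adjoint A * (hat m Xi * A)"
  proof (rule eq_matI)
    fix i j assume "i < dim_row (mat_adjoint A * (hat m Yi * A) - mat_adjoint A * (hat m Xi * A))"
      "j < dim_col (mat_adjoint A * (hat m Yi * A) - mat_adjoint A * (hat m Xi * A))"
    then show "F $$ (i, j) = (mat_adjoint A * (hat m Yi * A) - mat_adjoint A * (hat m Xi * A)) $$ (i, j)"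
      using eq[of i j] by (simp add: F_def algebra_simps del: index_mult_mat(1))
  qed auto
  also have "\<dots> = mat_adjoint B * (hat m Y * B) - mat_adjoint B * (hat m Y * (hat m Xi * (hat m Y * B)))"
  proof -
    have "hat m Yi * (hat m Y * B) = B"
      using IY by (simp add: one_mult_dim flip: mult_assoc_dim hat_mult)
    then show ?thesis
      unfolding A_eq by (simp add: adjoint_mult mult_assoc_dim aY flip: hat_adjoint)
  qed
  also have "\<dots> = mat_adjoint B * (hat m G * B)"
    by (simp add: G hat_minus hat_mult mat_dim_algebra)
  finally have F_eq: "F = mat_adjoint B * (hat m G * B)" .
  define q where "q = spectral_norm B"
  have q: "0 \<le> q" "q < 1" using contr by (auto simp: q_def B_def Yi_def)
  have Xi_psd: "0 \<le> Re ((F * (Xi * F) *\<^sub>v u) \<bullet>c u)" if u: "dim_vec u = n" for u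
  proof -
    define z where "z = Xi *\<^sub>v (F *\<^sub>v u)"
    have z: "dim_vec z = n" by (simp add: z_def)
    have Fu: "F *\<^sub>v u = X *\<^sub>v z"
      unfolding z_def using IX by (simp add: one_mult_vec_dim flip: mult_mult_vec_dim)
    have "(F * (Xi * F) *\<^sub>v u) \<bullet>c u = (F *\<^sub>v z) \<bullet>c u"
      using u by (simp add: mult_mult_vec_dim z_def)
    also have "\<dots> = z \<bullet>c (X *\<^sub>v z)"
      using F u z scalar_prod_adjoint[of z F u] by (simp add: hermitian_mat_def Fu)
    also have "\<dots> = (X *\<^sub>v z) \<bullet>c z"
      using aX z scalar_prod_adjoint[of z X z] by simp
    finally have eq: "(F * (Xi * F) *\<^sub>v u) \<bullet>c u = (X *\<^sub>v z) \<bullet>c z" .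
    show ?thesis
    proof (cases "z = 0\<^sub>v n")
      case True
      then show ?thesis unfolding eq by (simp add: scalar_prod_def)
    next
      case False
      then have "0 < Re ((X *\<^sub>v z) \<bullet>c z)"
        using X z by (auto simp: pos_def_mat_def intro: carrier_vecI)
      then show ?thesis unfolding eq by simp
    qed
  qed
  have step: "Re ((F *\<^sub>v v) \<bullet>c v) \<le> (C * q\<^sup>2) * (l2_vec_norm v)\<^sup>2"
    if C: "\<And>u. dim_vec u = n \<Longrightarrow> Re ((F *\<^sub>v u) \<bullet>c u) \<le> C * (l2_vec_norm u)\<^sup>2" "0 \<le> C"
      and v: "dim_vec v = n" for C v
  proof -
    have G_le: "Re ((G *\<^sub>v u) \<bullet>c u) \<le> C * (l2_vec_norm u)\<^sup>2" if u: "dim_vec u = n" for u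
    proof -
      have "(G *\<^sub>v u) \<bullet>c u = (F *\<^sub>v u) \<bullet>c u - (F * (Xi * F) *\<^sub>v u) \<bullet>c u"
        using u unfolding G_def
        by (subst minus_mult_vec_dim)
          (auto intro!: minus_scalar_prod_distrib[of _ n] carrier_vecI)
      then show ?thesis using C(1)[OF u] Xi_psd[OF u] by simp
    qed
    have "(F *\<^sub>v v) \<bullet>c v = (mat_adjoint B *\<^sub>v (hat m G *\<^sub>v (B *\<^sub>v v))) \<bullet>c v"
      using v by (subst F_eq) (simp add: mult_mult_vec_dim G)
    also have "\<dots> = (hat m G *\<^sub>v (B *\<^sub>v v)) \<bullet>c (B *\<^sub>v v)"
      using v by (subst scalar_prod_adjoint) (auto simp: G)
    finally have "Re ((F *\<^sub>v v) \<bullet>c v) \<le> C * (l2_vec_norm (B *\<^sub>v v))\<^sup>2"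
      using hat_quadratic_bound[of G n C "B *\<^sub>v v" m] G_le by (simp add: G)
    also have "\<dots> \<le> C * (q * l2_vec_norm v)\<^sup>2"
      using spectral_bound[of v B] v C(2) by (intro mult_left_mono power_mono) (auto simp: q_def)
    finally show ?thesis by (simp add: power_mult_distrib mult_ac)
  qed
  define C where "C = spectral_norm F"
  have pow: "Re ((F *\<^sub>v v) \<bullet>c v) \<le> (C * (q\<^sup>2) ^ k) * (l2_vec_norm v)\<^sup>2" if "dim_vec v = n" for k v
    using that
  proof (induction k arbitrary: v)
    case 0
    have "Re ((F *\<^sub>v v) \<bullet>c v) \<le> l2_vec_norm (F *\<^sub>v v) * l2_vec_norm v"
      using 0 by (intro Re_scalar_prod_le) auto
    also have "\<dots> \<le> (C * l2_vec_norm v) * l2_vec_norm v"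
      using spectral_bound[of v F] 0 by (intro mult_right_mono) (auto simp: C_def)
    finally show ?case by (simp add: power2_eq_square mult_ac)
  next
    case (Suc k)
    from step[of "C * (q\<^sup>2) ^ k" v] Suc show ?case by (simp add: C_def mult_ac)
  qed
  have "Re ((F *\<^sub>v v) \<bullet>c v) = 0" if v: "dim_vec v = n" for v
  proof (rule antisym)
    have "q\<^sup>2 < 1" using q by (simp add: power_less_one_iff abs_square_less_1)
    then have "(\<lambda>k. (C * (q\<^sup>2) ^ k) * (l2_vec_norm v)\<^sup>2) \<longlonglongrightarrow> (C * 0) * (l2_vec_norm v)\<^sup>2"
      by (intro tendsto_intros LIMSEQ_realpow_zero) auto
    then show "Re ((F *\<^sub>v v) \<bullet>c v) \<le> 0"
      using pow[OF v] by (intro LIMSEQ_le_const[where X="\<lambda>k. (C * (q\<^sup>2) ^ k) * (l2_vec_norm v)\<^sup>2"]) auto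
  qed (rule psd[OF v])
  with F have "F = 0\<^sub>m n n" by (rule hermitian_quadratic_zero)
  moreover have "X = F + Y" unfolding F_def by (rule eq_matI) auto
  ultimately show "X = Y" by (simp add: zero_add_dim)
qed

section \<open>Contractions on matrices\<close>

lemma spectral_le_sum_entries: "spectral_norm M \<le> (\<Sum>i<dim_row M. \<Sum>j<dim_col M. cmod (M $$ (i, j)))"
proof (rule spectral_least)
  fix v :: "complex vec" assume v: "dim_vec v = dim_col M"
  have "l2_vec_norm (M *\<^sub>v v) \<le> (\<Sum>i<dim_row M. cmod ((M *\<^sub>v v) $ i))"
    unfolding l2_vec_norm_eq using L2_set_le_sum[of "{..<dim_row M}" "\<lambda>i. cmod ((M *\<^sub>v v) $ i)"] by simp
  also have "\<dots> \<le> (\<Sum>i<dim_row M. \<Sum>j<dim_col M. cmod (M $$ (i, j)) * l2_vec_norm v)"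
  proof (rule sum_mono)
    fix i assume "i \<in> {..<dim_row M}"
    then have "cmod ((M *\<^sub>v v) $ i) \<le> (\<Sum>j<dim_col M. cmod (M $$ (i, j) * v $ j))"
      using v by (simp add: scalar_prod_def atLeast0LessThan norm_sum)
    also have "\<dots> \<le> (\<Sum>j<dim_col M. cmod (M $$ (i, j)) * l2_vec_norm v)"
      using v by (auto simp: norm_mult l2_vec_norm_eq intro!: sum_mono mult_left_mono member_le_L2_set)
    finally show "cmod ((M *\<^sub>v v) $ i) \<le> (\<Sum>j<dim_col M. cmod (M $$ (i, j)) * l2_vec_norm v)" .
  qed
  finally show "l2_vec_norm (M *\<^sub>v v) \<le> (\<Sum>i<dim_row M. \<Sum>j<dim_col M. cmod (M $$ (i, j))) * l2_vec_norm v"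
    by (simp add: sum_distrib_right)
qed (auto intro!: sum_nonneg)

lemma spectral_minus_commute:
  assumes "dim_row M = dim_row N" "dim_col M = dim_col N"
  shows "spectral_norm (M - N) = spectral_norm (N - M)"
proof -
  have "spectral_norm (M - N) \<le> spectral_norm (N - M)"
    if "dim_row M = dim_row N" "dim_col M = dim_col N" for M N
  proof -
    have "M - N = (-1) \<cdot>\<^sub>m (N - M)" using that by (intro eq_matI) auto
    then show ?thesis using spectral_smult[of "-1" "N - M"] by simp
  qed
  from this[of M N] this[of N M] assms show ?thesis by simp
qed

text \<open>Matrices of a size that is not a type form no metric space type, so the iteration is carried out
  entrywise: the entries of the iterates converge by comparison with a geometric series.\<close>

lemma matrix_contraction_fixpoint:
  assumes S: "\<And>H. H \<in> S \<Longrightarrow> H \<in> carrier_mat n n" and ne: "H0 \<in> S"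
    and f: "\<And>H. H \<in> S \<Longrightarrow> f H \<in> S"
    and q: "0 \<le> q" "q < 1"
    and contr: "\<And>H G. H \<in> S \<Longrightarrow> G \<in> S \<Longrightarrow> spectral_norm (f H - f G) \<le> q * spectral_norm (H - G)"
    and closed: "\<And>H L. (\<And>k. H k \<in> S) \<Longrightarrow> L \<in> carrier_mat n n
      \<Longrightarrow> (\<lambda>k. spectral_norm (H k - L)) \<longlonglongrightarrow> 0 \<Longrightarrow> L \<in> S"
  shows "\<exists>L\<in>S. f L = L"
proof -
  define H where "H = (\<lambda>k::nat. (f ^^ k) H0)"
  have H_Suc: "H (Suc k) = f (H k)" for k by (simp add: H_def)
  have HS: "H k \<in> S" for k
    by (induction k) (use ne f H_Suc in \<open>auto simp: H_def\<close>)
  have dims [simp]: "dim_row (H k) = n" "dim_col (H k) = n" for k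
    using S[OF HS[of k]] by auto
  define c where "c = spectral_norm (H 1 - H 0)"
  have geo: "spectral_norm (H (Suc k) - H k) \<le> c * q ^ k" for k
  proof (induction k)
    case (Suc k)
    have "spectral_norm (H (Suc (Suc k)) - H (Suc k)) \<le> q * spectral_norm (H (Suc k) - H k)"
      unfolding H_Suc[of "Suc k"] H_Suc[of k] using contr[OF HS HS] H_Suc by metis
    also have "\<dots> \<le> q * (c * q ^ k)" using Suc q by (intro mult_left_mono)
    finally show ?case by (simp add: mult_ac)
  qed (simp add: c_def)
  have conv: "convergent (\<lambda>k. H k $$ (i, j))" if ij: "i < n" "j < n" for i j
  proof -
    have "summable (\<lambda>k. H (Suc k) $$ (i, j) - H k $$ (i, j))"
    proof (rule summable_comparison_test')
      show "summable (\<lambda>k. c * q ^ k)"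
        using q by (intro summable_mult summable_geometric) auto
      fix k :: nat
      have "cmod (H (Suc k) $$ (i, j) - H k $$ (i, j)) \<le> spectral_norm (H (Suc k) - H k)"
        using entry_le_spectral[of i "H (Suc k) - H k" j] ij by simp
      then show "cmod (H (Suc k) $$ (i, j) - H k $$ (i, j)) \<le> c * q ^ k" using geo[of k] by linarith
    qed
    then have "convergent (\<lambda>k. (\<Sum>l<k. H (Suc l) $$ (i, j) - H l $$ (i, j)) + H 0 $$ (i, j))"
      by (intro convergent_add convergent_const) (simp add: summable_iff_convergent)
    then show ?thesis by (simp add: sum_lessThan_telescope[of "\<lambda>k. H k $$ (i, j)"])
  qed
  define L where "L = mat n n (\<lambda>(i, j). lim (\<lambda>k. H k $$ (i, j)))"
  have L: "L \<in> carrier_mat n n" by (simp add: L_def)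
  then have dimL [simp]: "dim_row L = n" "dim_col L = n" by auto
  have "(\<lambda>k. \<Sum>i<n. \<Sum>j<n. cmod (H k $$ (i, j) - L $$ (i, j))) \<longlonglongrightarrow> (\<Sum>i<n. \<Sum>j<n. cmod 0)"
  proof (intro tendsto_sum tendsto_norm)
    fix i j assume "i \<in> {..<n}" "j \<in> {..<n}"
    then have "(\<lambda>k. H k $$ (i, j)) \<longlonglongrightarrow> L $$ (i, j)"
      using conv[of i j] by (simp add: L_def convergent_LIMSEQ_iff)
    then show "(\<lambda>k. H k $$ (i, j) - L $$ (i, j)) \<longlonglongrightarrow> 0" using LIM_zero by blast
  qed
  then have sum0: "(\<lambda>k. \<Sum>i<n. \<Sum>j<n. cmod (H k $$ (i, j) - L $$ (i, j))) \<longlonglongrightarrow> 0" by simp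
  have lim: "(\<lambda>k. spectral_norm (H k - L)) \<longlonglongrightarrow> 0"
  proof (rule tendsto_sandwich[OF _ _ tendsto_const sum0])
    show "\<forall>\<^sub>F k in sequentially. spectral_norm (H k - L) \<le> (\<Sum>i<n. \<Sum>j<n. cmod (H k $$ (i, j) - L $$ (i, j)))"
    proof (rule always_eventually, rule allI)
      fix k
      have "(\<Sum>i<n. \<Sum>j<n. cmod ((H k - L) $$ (i, j))) = (\<Sum>i<n. \<Sum>j<n. cmod (H k $$ (i, j) - L $$ (i, j)))"
        by (intro sum.cong refl) simp
      then show "spectral_norm (H k - L) \<le> (\<Sum>i<n. \<Sum>j<n. cmod (H k $$ (i, j) - L $$ (i, j)))"
        using spectral_le_sum_entries[of "H k - L"] by simp
    qed
  qed simp
  have LS: "L \<in> S" by (rule closed[OF HS L lim])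
  have dimfL [simp]: "dim_row (f L) = n" "dim_col (f L) = n" using S[OF f[OF LS]] by auto
  have "spectral_norm (f L - L) \<le> q * spectral_norm (H k - L) + spectral_norm (H (Suc k) - L)" for k
  proof -
    have "f L - L = (f L - H (Suc k)) + (H (Suc k) - L)" by (rule eq_matI) auto
    then have "spectral_norm (f L - L) \<le> spectral_norm (f L - H (Suc k)) + spectral_norm (H (Suc k) - L)"
      using spectral_add[of "f L - H (Suc k)" "H (Suc k) - L"] by simp
    also have "spectral_norm (f L - H (Suc k)) \<le> q * spectral_norm (L - H k)"
      unfolding H_Suc by (rule contr[OF LS HS])
    also have "spectral_norm (L - H k) = spectral_norm (H k - L)"
      by (rule spectral_minus_commute) auto
    finally show ?thesis by simp
  qed
  moreover have "(\<lambda>k. q * spectral_norm (H k - L) + spectral_norm (H (Suc k) - L)) \<longlonglongrightarrow> q * 0 + 0"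
    by (intro tendsto_intros lim LIMSEQ_Suc[OF lim])
  ultimately have "spectral_norm (f L - L) \<le> 0"
    by (intro LIMSEQ_le_const[where X="\<lambda>k. q * spectral_norm (H k - L) + spectral_norm (H (Suc k) - L)"]) auto
  then have "(f L - L) $$ (i, j) = 0" if "i < n" "j < n" for i j
    using spectral_norm_zero_entry[of "f L - L"] that by simp
  then have "f L = L" by (intro eq_matI) auto
  with LS show ?thesis by blast
qed

section \<open>The perturbed equation near a solution\<close>

text \<open>The normalised situation: \<open>V\<close> is the inverse of the unperturbed solution \<open>X\<close>, and \<open>\<Delta>\<close>, \<open>\<Delta>Q\<close> are the
  perturbations of the coefficients. The right-hand side of the equation is whatever \<open>X\<close> makes it.
  The last two assumptions are what the radius \<open>h\<close> has to satisfy for the ball of that radius to be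
  mapped to itself by a contraction.\<close>

locale perturbation =
  fixes m n :: nat and X V A \<Delta> \<Delta>Q :: "complex mat" and \<nu> :: "complex mat \<Rightarrow> real"
    and \<theta> K w l dA dQ h :: real
  assumes \<nu>: "unitarily_invariant_norm \<nu>"
    and \<theta>: "\<And>H. H \<in> carrier_mat n n \<Longrightarrow> \<nu> (hat m H) \<le> \<theta> * \<nu> H"
    and X: "hermitian_mat n X" and V: "hermitian_mat n V" and XV: "X * V = 1\<^sub>m n"
    and A: "A \<in> carrier_mat (m * n) n" and \<Delta>: "\<Delta> \<in> carrier_mat (m * n) n"
    and \<Delta>Q: "hermitian_mat n \<Delta>Q"
    and w: "w = spectral_norm (hat m V * A)" and l: "l = spectral_norm V"
    and dA: "dA = \<nu> \<Delta>" and dQ: "dQ = \<nu> \<Delta>Q"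
    and K: "K = min (\<theta> * w) (\<nu> (hat m V * A))" and K0: "0 \<le> K"
    and h: "0 \<le> h" and small: "l * h + w + l * dA < 1"
    and self_map: "dQ + (K * w * h + 2 * w * dA + l * dA\<^sup>2) / (1 - l * h) \<le> h"
begin

definition ball :: "complex mat set" where
  "ball = {H. hermitian_mat n H \<and> \<nu> H \<le> h}"

definition W where "W = hat m V * A"

definition q where "q = (w + l * dA) / (1 - l * h)"

text \<open>Among the elements of \<open>ball\<close>, the fixed points \<open>H\<close> are the solutions \<open>X + H\<close> of the perturbed equation.\<close>

definition step_map where
  "step_map H = \<Delta>Q + mat_adjoint A * (hat m V * A)
     - mat_adjoint (A + \<Delta>) * (hat m (mat_inv (X + H)) * (A + \<Delta>))"

lemma dims [simp]: "dim_row X = n" "dim_col X = n" "dim_row V = n" "dim_col V = n"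
  "dim_row A = m * n" "dim_col A = n" "dim_row \<Delta> = m * n" "dim_col \<Delta> = n"
  "dim_row \<Delta>Q = n" "dim_col \<Delta>Q = n" "dim_row W = m * n" "dim_col W = n"
  "dim_row (step_map H) = n" "dim_col (step_map H) = n"
  using X V A \<Delta> \<Delta>Q by (auto simp: hermitian_mat_def W_def step_map_def)

lemma adj: "mat_adjoint X = X" "mat_adjoint V = V" "mat_adjoint \<Delta>Q = \<Delta>Q"
  using X V \<Delta>Q by (auto simp: hermitian_mat_def)

lemma nonneg: "0 \<le> l" "0 \<le> w" "0 \<le> dA" "0 \<le> dQ"
  using uin_nonneg[OF \<nu>] by (auto simp: l w dA dQ)

lemma lh: "l * h < 1"
  using small nonneg mult_nonneg_nonneg[of l dA] by linarith

lemma q_bounds: "0 \<le> q" "q < 1"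
  using small lh nonneg by (auto simp: q_def)

lemma ballD:
  assumes "H \<in> ball"
  shows "dim_row H = n" "dim_col H = n" "mat_adjoint H = H" "\<nu> H \<le> h" "hermitian_mat n H"
  using assms by (auto simp: ball_def hermitian_mat_def)

lemma neumann_factor:
  assumes H: "H \<in> ball"
  obtains N where "dim_row N = n" "dim_col N = n" "(1\<^sub>m n + V * H) * N = 1\<^sub>m n" "N * (1\<^sub>m n + V * H) = 1\<^sub>m n"
    "spectral_norm N \<le> 1 / (1 - l * h)"
proof -
  note [simp] = ballD(1,2)[OF H]
  have "spectral_norm (V * H) \<le> l * spectral_norm H"
    unfolding l by (rule spectral_mult) simp
  also have "\<dots> \<le> l * h"
    using spectral_le_uin[OF \<nu>, of H] ballD[OF H] nonneg by (intro mult_left_mono) auto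
  finally have *: "spectral_norm (V * H) \<le> l * h" .
  have "V * H \<in> carrier_mat n n" by (auto intro!: carrier_matI)
  from one_plus_invertible[OF this * lh] that show ?thesis by (metis carrier_matD)
qed

lemma inverse_factorisation:
  assumes H: "H \<in> ball" and N: "dim_row N = n" "dim_col N = n" "(1\<^sub>m n + V * H) * N = 1\<^sub>m n"
  shows "mat_inv (X + H) = N * V" "invertible_mat (X + H)"
proof -
  note [simp] = ballD(1,2)[OF H] N(1,2)
  have c: "X + H \<in> carrier_mat n n" "N * V \<in> carrier_mat n n" by (auto intro!: carrier_matI)
  have "X * (1\<^sub>m n + V * H) = X + H"
    using XV by (simp add: mult_add_dim one_mult_dim flip: mult_assoc_dim)
  then have "(X + H) * (N * V) = X * ((1\<^sub>m n + V * H) * N) * V"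
    by (simp flip: mult_assoc_dim)
  also have "\<dots> = 1\<^sub>m n" using N XV by (simp add: one_mult_dim)
  finally show "mat_inv (X + H) = N * V" "invertible_mat (X + H)"
    using mat_inv_eqI[OF c] by auto
qed

lemma ball_invertible: "H \<in> ball \<Longrightarrow> invertible_mat (X + H)"
  using neumann_factor inverse_factorisation by metis

lemma ball_inverse:
  assumes H: "H \<in> ball"
  shows "dim_row (mat_inv (X + H)) = n" "dim_col (mat_inv (X + H)) = n"
    "(X + H) * mat_inv (X + H) = 1\<^sub>m n" "mat_inv (X + H) * (X + H) = 1\<^sub>m n"
    "mat_adjoint (mat_inv (X + H)) = mat_inv (X + H)"
proof -
  note [simp] = ballD(1,2)[OF H]
  have c: "X + H \<in> carrier_mat n n" by (auto intro!: carrier_matI)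
  note I = mat_inv_invertible[OF c ball_invertible[OF H]]
  from I show "dim_row (mat_inv (X + H)) = n" "dim_col (mat_inv (X + H)) = n"
    "(X + H) * mat_inv (X + H) = 1\<^sub>m n" "mat_inv (X + H) * (X + H) = 1\<^sub>m n" by auto
  have "hermitian_mat n (X + H)"
    using c adj ballD[OF H] by (simp add: hermitian_mat_def adjoint_add)
  then show "mat_adjoint (mat_inv (X + H)) = mat_inv (X + H)"
    using mat_inv_hermitian ball_invertible[OF H] by blast
qed

lemma spectral_hat_le: "spectral_norm M \<le> a \<Longrightarrow> spectral_norm (hat m M) \<le> a"
  using spectral_hat order.trans by blast

lemma spectral_\<Delta>: "spectral_norm \<Delta> \<le> dA"
  using spectral_le_uin[OF \<nu>] by (simp add: dA)

text \<open>\<open>(X + H)\<^sup>-\<^sup>1 = N V\<close> gives \<open>hat (X + H)\<^sup>-\<^sup>1 (A + \<Delta>) = hat N (W + hat V \<Delta>)\<close>.\<close>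

lemma contraction_factor:
  assumes H: "H \<in> ball"
  shows "spectral_norm (hat m (mat_inv (X + H)) * (A + \<Delta>)) \<le> q"
proof -
  obtain N where N: "dim_row N = n" "dim_col N = n" "(1\<^sub>m n + V * H) * N = 1\<^sub>m n"
    "spectral_norm N \<le> 1 / (1 - l * h)" using neumann_factor[OF H] by metis
  note [simp] = N(1,2)
  have "hat m (mat_inv (X + H)) * (A + \<Delta>) = hat m N * (W + hat m V * \<Delta>)"
    unfolding inverse_factorisation[OF H N(1-3)] W_def
    by (simp add: hat_mult mat_dim_algebra)
  then have "spectral_norm (hat m (mat_inv (X + H)) * (A + \<Delta>))
      \<le> spectral_norm (hat m N) * spectral_norm (W + hat m V * \<Delta>)"
    by (simp add: spectral_mult)
  also have "\<dots> \<le> 1 / (1 - l * h) * (w + l * dA)"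
  proof (rule mult_mono)
    show "spectral_norm (hat m N) \<le> 1 / (1 - l * h)" by (rule spectral_hat_le[OF N(4)])
    have "spectral_norm (W + hat m V * \<Delta>) \<le> spectral_norm W + spectral_norm (hat m V * \<Delta>)"
      by (rule spectral_add) auto
    also have "spectral_norm (hat m V * \<Delta>) \<le> spectral_norm (hat m V) * spectral_norm \<Delta>"
      by (rule spectral_mult) simp
    also have "\<dots> \<le> l * dA"
      using spectral_hat[of m V] spectral_\<Delta> nonneg by (intro mult_mono) (auto simp: l)
    finally show "spectral_norm (W + hat m V * \<Delta>) \<le> w + l * dA" by (simp add: w W_def)
  qed (use lh in auto)
  finally show ?thesis by (simp add: q_def)
qed

text \<open>By \<open>Z - Y = Z (Y\<^sup>-\<^sup>1 - Z\<^sup>-\<^sup>1) Y\<close> for the two inverses involved, the difference of the values is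
  \<open>C\<^sup>* hat (H - G) B\<close> with two factors of the kind estimated by \<open>contraction_factor\<close>.\<close>

lemma step_map_contraction:
  assumes H: "H \<in> ball" and G: "G \<in> ball"
  shows "spectral_norm (step_map H - step_map G) \<le> q\<^sup>2 * spectral_norm (H - G)"
proof -
  define Y where "Y = mat_inv (X + H)"
  define Z where "Z = mat_inv (X + G)"
  note IY = ball_inverse[OF H, folded Y_def] and IZ = ball_inverse[OF G, folded Z_def]
  note [simp] = ballD(1,2)[OF H] ballD(1,2)[OF G] IY(1,2) IZ(1,2)
  define B where "B = hat m Y * (A + \<Delta>)"
  define C where "C = hat m Z * (A + \<Delta>)"
  have [simp]: "dim_row B = m * n" "dim_col B = n" "dim_row C = m * n" "dim_col C = n"
    by (auto simp: B_def C_def)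
  have "Z - Y = Z * ((X + H) * Y) - Z * (X + G) * Y"
    using IY IZ by (simp add: one_mult_dim)
  also have "\<dots> = Z * ((H - G) * Y)"
    by (rule eq_matI) (simp_all add: mat_dim_algebra algebra_simps del: index_mult_mat(1))
  finally have ZY: "Z - Y = Z * ((H - G) * Y)" .
  have "step_map H - step_map G = mat_adjoint (A + \<Delta>) * (hat m Z * (A + \<Delta>)) - mat_adjoint (A + \<Delta>) * (hat m Y * (A + \<Delta>))"
    unfolding step_map_def Y_def[symmetric] Z_def[symmetric] by (rule eq_matI) (auto simp del: index_mult_mat(1))
  also have "\<dots> = mat_adjoint (A + \<Delta>) * (hat m (Z - Y) * (A + \<Delta>))"
    by (subst hat_minus, simp, simp, subst minus_mult_dim, simp, simp, simp, subst mult_minus_dim) auto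
  also have "\<dots> = mat_adjoint (A + \<Delta>) * (hat m Z * (hat m (H - G) * B))"
    unfolding ZY B_def by (simp add: hat_mult mult_assoc_dim)
  also have "\<dots> = mat_adjoint C * (hat m (H - G) * B)"
    unfolding C_def using IZ(5) by (simp add: adjoint_mult mult_assoc_dim flip: hat_adjoint)
  finally have eq: "step_map H - step_map G = mat_adjoint C * (hat m (H - G) * B)" .
  have "spectral_norm (step_map H - step_map G) \<le> spectral_norm (mat_adjoint C) * spectral_norm (hat m (H - G) * B)"
    unfolding eq by (rule spectral_mult) simp
  also have "\<dots> \<le> spectral_norm C * (spectral_norm (hat m (H - G)) * spectral_norm B)"
    unfolding spectral_adjoint by (intro mult_left_mono spectral_mult) auto
  also have "\<dots> \<le> q * (spectral_norm (H - G) * q)"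
    using contraction_factor[OF H] contraction_factor[OF G] q_bounds
    by (intro mult_mono spectral_hat) (auto simp: B_def C_def Y_def Z_def)
  finally show ?thesis by (simp add: power2_eq_square mult_ac)
qed

lemma step_map_hermitian:
  assumes H: "H \<in> ball"
  shows "hermitian_mat n (step_map H)"
proof -
  note I = ball_inverse[OF H]
  have "mat_adjoint (step_map H) = step_map H"
    unfolding step_map_def using I adj
    by (simp add: adjoint_add adjoint_minus adjoint_mult mult_assoc_dim flip: hat_adjoint)
  then show ?thesis by (auto simp: hermitian_mat_def intro!: carrier_matI)
qed

text \<open>Isolates the contributions of \<open>H\<close>, of \<open>\<Delta>\<close> to first order and of \<open>\<Delta>\<close> to second order. The first
  of them comes from \<open>V - N V = V H N V\<close>; that \<open>(X + H)\<^sup>-\<^sup>1 = N V = V N\<^sup>*\<close> is Hermitian allows the factor \<open>W\<close> to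
  appear in both first order terms.\<close>

lemma step_map_split:
  assumes H: "H \<in> ball" and N: "dim_row N = n" "dim_col N = n" "(1\<^sub>m n + V * H) * N = 1\<^sub>m n"
  shows "step_map H = \<Delta>Q + mat_adjoint W * hat m H * (hat m N * W)
     - (mat_adjoint \<Delta> * (hat m N * W) + mat_adjoint W * mat_adjoint (hat m N) * \<Delta>)
     - mat_adjoint \<Delta> * hat m (N * V) * \<Delta>"
proof -
  note [simp] = ballD(1,2)[OF H] N(1,2)
  define Y where "Y = mat_inv (X + H)"
  note I = ball_inverse[OF H, folded Y_def]
  note [simp] = I(1,2)
  have Y: "Y = N * V" using inverse_factorisation[OF H N] by (simp add: Y_def)
  have Yadj: "Y = V * mat_adjoint N"
    using arg_cong[OF Y, of mat_adjoint] I(5) adj by (simp add: adjoint_mult)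
  \<comment> \<open>Multiplying the defining equation of \<open>N\<close> by \<open>V\<close> expresses \<open>V\<close> through \<open>Y\<close>.\<close>
  have N1: "N + V * (H * N) = 1\<^sub>m n" using N(3) by (simp add: mat_dim_algebra)
  have "V = (N + V * (H * N)) * V" unfolding N1 by (simp add: one_mult_dim)
  also have "\<dots> = Y + V * (H * (N * V))" unfolding Y by (simp add: mat_dim_algebra)
  finally have V_eq: "V = Y + V * (H * (N * V))" .
  have WA: "mat_adjoint W = mat_adjoint A * hat m V"
    using adj by (simp add: W_def adjoint_mult flip: hat_adjoint)
  have T1: "mat_adjoint A * (hat m V * A) = mat_adjoint A * (hat m Y * A) + mat_adjoint W * hat m H * (hat m N * W)"
  proof -
    have "hat m V = hat m Y + hat m V * (hat m H * (hat m N * hat m V))"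
      using arg_cong[OF V_eq, of "hat m"] by (simp add: hat_add hat_mult)
    then have "mat_adjoint A * (hat m V * A)
      = mat_adjoint A * ((hat m Y + hat m V * (hat m H * (hat m N * hat m V))) * A)" by simp
    then show ?thesis unfolding WA unfolding W_def by (simp add: mat_dim_algebra)
  qed
  have T2: "mat_adjoint \<Delta> * (hat m Y * A) = mat_adjoint \<Delta> * (hat m N * W)"
    unfolding Y W_def by (simp add: hat_mult mult_assoc_dim)
  have T3: "mat_adjoint A * (hat m Y * \<Delta>) = mat_adjoint W * mat_adjoint (hat m N) * \<Delta>"
    unfolding Yadj WA by (simp add: hat_mult hat_adjoint mult_assoc_dim)
  have T4: "mat_adjoint \<Delta> * (hat m Y * \<Delta>) = mat_adjoint \<Delta> * hat m (N * V) * \<Delta>"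
    unfolding Y by (simp add: mult_assoc_dim)
  have "mat_adjoint (A + \<Delta>) * (hat m Y * (A + \<Delta>))
    = (mat_adjoint A * (hat m Y * A) + mat_adjoint A * (hat m Y * \<Delta>))
      + (mat_adjoint \<Delta> * (hat m Y * A) + mat_adjoint \<Delta> * (hat m Y * \<Delta>))"
    by (rule eq_matI) (simp_all add: mat_dim_algebra algebra_simps del: index_mult_mat(1))
  then show ?thesis
    unfolding step_map_def Y_def[symmetric] T1 T2 T3 T4
    by simp (rule eq_matI, auto simp del: index_mult_mat(1))
qed

text \<open>The two candidates in the minimum \<open>K\<close> correspond to putting the norm \<open>\<nu>\<close> on the middle factor
  \<open>hat H\<close>, at the cost of \<open>\<theta>\<close>, or on the outer factor \<open>W\<close>.\<close>

lemma W_hat_bound: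
  assumes H: "H \<in> ball" and N: "dim_row N = n" "dim_col N = n" "spectral_norm N \<le> r"
  shows "\<nu> (mat_adjoint W * hat m H * (hat m N * W)) \<le> K * w * h * r"
proof -
  note [simp] = ballD(1,2)[OF H] N(1,2)
  have r: "0 \<le> r" using N(3) spectral_nonneg[of N] by linarith
  have wW: "spectral_norm W = w" by (simp add: w W_def)
  have hN: "spectral_norm (hat m N) \<le> r" by (rule spectral_hat_le[OF N(3)])
  have \<nu>H: "0 \<le> \<nu> H" by (rule uin_nonneg[OF \<nu>])
  have th: "\<nu> (mat_adjoint W * hat m H * (hat m N * W)) \<le> (\<theta> * w) * w * \<nu> H * r"
  proof -
    have "\<nu> (mat_adjoint W * hat m H * (hat m N * W))
        \<le> spectral_norm (mat_adjoint W) * \<nu> (hat m H) * spectral_norm (hat m N * W)"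
      by (rule uin_mult3[OF \<nu>]) auto
    also have "\<dots> \<le> w * (\<theta> * \<nu> H) * (r * w)"
    proof (intro mult_mono)
      show "\<nu> (hat m H) \<le> \<theta> * \<nu> H" by (rule \<theta>) (auto intro!: carrier_matI)
      then have "0 \<le> \<theta> * \<nu> H" using uin_nonneg[OF \<nu>, of "hat m H"] by linarith
      then show "0 \<le> w * (\<theta> * \<nu> H)" using nonneg by simp
      have "spectral_norm (hat m N * W) \<le> spectral_norm (hat m N) * spectral_norm W"
        by (rule spectral_mult) simp
      also have "\<dots> \<le> r * w" unfolding wW using hN nonneg by (intro mult_right_mono) auto
      finally show "spectral_norm (hat m N * W) \<le> r * w" .
    qed (use nonneg uin_nonneg[OF \<nu>] in \<open>auto simp: spectral_adjoint wW\<close>)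
    finally show ?thesis by (simp add: mult_ac)
  qed
  have nu: "\<nu> (mat_adjoint W * hat m H * (hat m N * W)) \<le> \<nu> W * w * \<nu> H * r"
  proof -
    have eq: "mat_adjoint W * hat m H * (hat m N * W) = (mat_adjoint W * (hat m H * hat m N)) * W"
      by (simp add: mult_assoc_dim)
    have "\<nu> (mat_adjoint W * hat m H * (hat m N * W))
        \<le> spectral_norm (mat_adjoint W * (hat m H * hat m N)) * \<nu> W"
      unfolding eq by (rule uin_mult_left[OF \<nu>]) simp
    also have "\<dots> \<le> (w * (\<nu> H * r)) * \<nu> W"
    proof (rule mult_right_mono)
      have "spectral_norm (mat_adjoint W * (hat m H * hat m N))
        \<le> spectral_norm (mat_adjoint W) * spectral_norm (hat m H * hat m N)"
        by (rule spectral_mult) simp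
      also have "\<dots> \<le> w * (spectral_norm (hat m H) * spectral_norm (hat m N))"
        unfolding spectral_adjoint wW using nonneg by (intro mult_left_mono spectral_mult) auto
      also have "\<dots> \<le> w * (\<nu> H * r)"
        using hN nonneg \<nu>H spectral_hat_le[OF spectral_le_uin[OF \<nu>, of H]]
        by (intro mult_left_mono mult_mono) auto
      finally show "spectral_norm (mat_adjoint W * (hat m H * hat m N)) \<le> w * (\<nu> H * r)" .
    qed (rule uin_nonneg[OF \<nu>])
    finally show ?thesis by (simp add: mult_ac)
  qed
  have "\<nu> (mat_adjoint W * hat m H * (hat m N * W)) \<le> K * (w * \<nu> H * r)"
    using th nu by (auto simp: K W_def min_def mult.assoc)
  also have "\<dots> \<le> K * (w * h * r)"
    using K0 nonneg r ballD(4)[OF H] by (intro mult_left_mono mult_right_mono) auto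
  finally show ?thesis by (simp add: mult_ac)
qed

text \<open>The first order terms are adjoint to each other; the norm of the one with \<open>\<Delta>\<close> on the left
  is estimated by way of \<open>uin_adjoint\<close>.\<close>

lemma step_map_ball:
  assumes H: "H \<in> ball"
  shows "step_map H \<in> ball"
proof -
  define r where "r = 1 / (1 - l * h)"
  have r: "0 \<le> r" using lh by (simp add: r_def)
  obtain N where N: "dim_row N = n" "dim_col N = n" "(1\<^sub>m n + V * H) * N = 1\<^sub>m n"
    "spectral_norm N \<le> r" using neumann_factor[OF H] unfolding r_def by metis
  note [simp] = ballD(1,2)[OF H] N(1,2)
  have wW: "spectral_norm W = w" by (simp add: w W_def)
  have hN: "spectral_norm (hat m N) \<le> r" by (rule spectral_hat_le[OF N(4)])
  let ?T1 = "mat_adjoint W * hat m H * (hat m N * W)"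
  let ?T2 = "mat_adjoint \<Delta> * (hat m N * W)"
  let ?T3 = "mat_adjoint W * mat_adjoint (hat m N) * \<Delta>"
  let ?T4 = "mat_adjoint \<Delta> * hat m (N * V) * \<Delta>"
  have T3: "\<nu> ?T3 \<le> w * r * dA"
  proof -
    have "\<nu> ?T3 \<le> spectral_norm (mat_adjoint W * mat_adjoint (hat m N)) * \<nu> \<Delta>"
      by (rule uin_mult_left[OF \<nu>]) simp
    also have "\<dots> \<le> w * r * dA"
    proof (rule mult_mono)
      have "spectral_norm (mat_adjoint W * mat_adjoint (hat m N)) \<le> spectral_norm W * spectral_norm (hat m N)"
        using spectral_mult[of "mat_adjoint W" "mat_adjoint (hat m N)"] by (simp add: spectral_adjoint)
      also have "\<dots> \<le> w * r" unfolding wW using hN nonneg by (intro mult_left_mono)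
      finally show "spectral_norm (mat_adjoint W * mat_adjoint (hat m N)) \<le> w * r" .
    qed (use nonneg r uin_nonneg[OF \<nu>] in \<open>auto simp: dA\<close>)
    finally show ?thesis .
  qed
  have T2: "\<nu> ?T2 \<le> w * r * dA"
  proof -
    have "?T2 = mat_adjoint ?T3" by (simp add: adjoint_mult mult_assoc_dim)
    moreover have "?T3 \<in> carrier_mat n n" by (auto intro!: carrier_matI)
    ultimately have "\<nu> ?T2 \<le> \<nu> ?T3" using uin_adjoint[OF \<nu>] by metis
    then show ?thesis using T3 by simp
  qed
  have T4: "\<nu> ?T4 \<le> dA * (r * l) * dA"
  proof -
    have "\<nu> ?T4 \<le> spectral_norm (mat_adjoint \<Delta> * hat m (N * V)) * \<nu> \<Delta>"
      by (rule uin_mult_left[OF \<nu>]) simp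
    also have "\<dots> \<le> dA * (r * l) * dA"
    proof (rule mult_mono)
      have "spectral_norm (mat_adjoint \<Delta> * hat m (N * V)) \<le> spectral_norm \<Delta> * spectral_norm (hat m (N * V))"
        using spectral_mult[of "mat_adjoint \<Delta>" "hat m (N * V)"] by (simp add: spectral_adjoint)
      also have "\<dots> \<le> dA * (r * l)"
      proof (intro mult_mono spectral_\<Delta> spectral_hat_le)
        have "spectral_norm (N * V) \<le> spectral_norm N * spectral_norm V" by (rule spectral_mult) simp
        also have "\<dots> \<le> r * l" using N(4) nonneg unfolding l by (intro mult_right_mono) auto
        finally show "spectral_norm (N * V) \<le> r * l" .
      qed (use nonneg in auto)
      finally show "spectral_norm (mat_adjoint \<Delta> * hat m (N * V)) \<le> dA * (r * l)" .
    qed (use nonneg r uin_nonneg[OF \<nu>] in \<open>auto simp: dA\<close>)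
    finally show ?thesis .
  qed
  have "\<nu> (step_map H) \<le> \<nu> (\<Delta>Q + ?T1 - (?T2 + ?T3)) + \<nu> ?T4"
    unfolding step_map_split[OF H N(1-3)] by (rule uin_minus[OF \<nu>]) auto
  also have "\<dots> \<le> \<nu> (\<Delta>Q + ?T1) + \<nu> (?T2 + ?T3) + \<nu> ?T4"
    using uin_minus[OF \<nu>, of "\<Delta>Q + ?T1" "?T2 + ?T3"] by simp
  also have "\<dots> \<le> (\<nu> \<Delta>Q + \<nu> ?T1) + (\<nu> ?T2 + \<nu> ?T3) + \<nu> ?T4"
    by (intro add_mono uin_add[OF \<nu>]) auto
  also have "\<dots> \<le> (dQ + K * w * h * r) + (w * r * dA + w * r * dA) + dA * (r * l) * dA"
    by (intro add_mono T2 T3 T4 W_hat_bound[OF H N(1,2,4)]) (simp add: dQ)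
  also have "\<dots> = dQ + (K * w * h + 2 * w * dA + l * dA\<^sup>2) * r"
    by (simp add: algebra_simps power2_eq_square)
  also have "\<dots> \<le> h" using self_map by (simp add: r_def)
  finally show ?thesis using step_map_hermitian[OF H] by (simp add: ball_def)
qed

lemma perturbed_solution_exists:
  "\<exists>H. hermitian_mat n H \<and> \<nu> H \<le> h \<and> invertible_mat (X + H) \<and>
    X + H + mat_adjoint (A + \<Delta>) * mat_inv (hat m (X + H)) * (A + \<Delta>)
      = X + mat_adjoint A * (hat m V * A) + \<Delta>Q \<and>
    spectral_norm (hat m (mat_inv (X + H)) * (A + \<Delta>)) < 1"
proof -
  have "\<exists>L\<in>ball. step_map L = L"
  proof (rule matrix_contraction_fixpoint[of _ n "0\<^sub>m n n" step_map "q\<^sup>2"])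
    show "H \<in> carrier_mat n n" if "H \<in> ball" for H using ballD[OF that] by (auto intro!: carrier_matI)
    \<comment> \<open>The iteration starts at the unperturbed solution.\<close>
    show "0\<^sub>m n n \<in> ball" using h by (simp add: ball_def hermitian_mat_def uin_zero[OF \<nu>])
    show "0 \<le> q\<^sup>2" "q\<^sup>2 < 1" using q_bounds by (auto simp: power_less_one_iff abs_square_less_1)
    fix H :: "nat \<Rightarrow> complex mat" and L
    assume H: "\<And>k. H k \<in> ball" and L: "L \<in> carrier_mat n n"
      and lim: "(\<lambda>k. spectral_norm (H k - L)) \<longlonglongrightarrow> 0"
    have [simp]: "dim_row (H k) = n" "dim_col (H k) = n" for k using ballD[OF H] by auto
    have [simp]: "dim_row L = n" "dim_col L = n" using L by auto
    have "spectral_norm (mat_adjoint L - L) \<le> 2 * spectral_norm (H k - L)" for k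
    proof -
      have "mat_adjoint L - L = mat_adjoint (L - H k) + (H k - L)"
        using ballD(3)[OF H[of k]] by (simp add: adjoint_minus) (rule eq_matI, auto)
      then have "spectral_norm (mat_adjoint L - L)
          \<le> spectral_norm (mat_adjoint (L - H k)) + spectral_norm (H k - L)"
        using spectral_add[of "mat_adjoint (L - H k)" "H k - L"] by simp
      then show ?thesis using spectral_minus_commute[of L "H k"] by (simp add: spectral_adjoint)
    qed
    moreover have "(\<lambda>k. 2 * spectral_norm (H k - L)) \<longlonglongrightarrow> 2 * 0" by (intro tendsto_intros lim)
    ultimately have "spectral_norm (mat_adjoint L - L) \<le> 0"
      by (intro LIMSEQ_le_const[where X="\<lambda>k. 2 * spectral_norm (H k - L)"]) auto
    then have "mat_adjoint L $$ (i, j) = L $$ (i, j)" if "i < n" "j < n" for i j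
      using spectral_norm_zero_entry[of "mat_adjoint L - L" i j] that by simp
    then have "mat_adjoint L = L" by (intro eq_matI) (auto simp del: adjoint_index)
    moreover have "\<nu> L \<le> h"
    proof -
      have "\<nu> L \<le> h + spectral_norm (H k - L) * \<nu> (1\<^sub>m n)" for k
      proof -
        have "L = H k - (H k - L)" by (rule eq_matI) auto
        then have "\<nu> L \<le> \<nu> (H k) + \<nu> (H k - L)" using uin_minus[OF \<nu>, of "H k" "H k - L"] by simp
        then show ?thesis using ballD(4)[OF H[of k]] uin_le_spectral[OF \<nu>, of "H k - L"] by simp
      qed
      moreover have "(\<lambda>k. h + spectral_norm (H k - L) * \<nu> (1\<^sub>m n)) \<longlonglongrightarrow> h + 0 * \<nu> (1\<^sub>m n)"
        by (intro tendsto_intros lim)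
      ultimately show ?thesis
        by (intro LIMSEQ_le_const[where X="\<lambda>k. h + spectral_norm (H k - L) * \<nu> (1\<^sub>m n)"]) auto
    qed
    ultimately show "L \<in> ball" using L by (simp add: ball_def hermitian_mat_def)
  qed (use step_map_ball step_map_contraction in auto)
  then obtain H where H: "H \<in> ball" and fp: "step_map H = H" by blast
  note [simp] = ballD(1,2)[OF H]
  have c: "X + H \<in> carrier_mat n n" by (auto intro!: carrier_matI)
  have "X + H + mat_adjoint (A + \<Delta>) * (hat m (mat_inv (X + H)) * (A + \<Delta>))
      = X + mat_adjoint A * (hat m V * A) + \<Delta>Q"
    by (subst (1) fp[symmetric], unfold step_map_def, rule eq_matI) (auto simp del: index_mult_mat(1) simp: ball_inverse[OF H])
  then have "X + H + mat_adjoint (A + \<Delta>) * mat_inv (hat m (X + H)) * (A + \<Delta>)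
      = X + mat_adjoint A * (hat m V * A) + \<Delta>Q"
    using mat_inv_hat[OF c ball_invertible[OF H], of m] ball_inverse[OF H] by (simp add: mult_assoc_dim)
  then show ?thesis
    using ballD[OF H] ball_invertible[OF H] contraction_factor[OF H] q_bounds by (intro exI[of _ H]) auto
qed

end

section \<open>The quadratic equation behind the bound\<close>

text \<open>With \<open>s = \<surd>k\<close>, \<open>x = l dQ\<close>, \<open>y = l dA\<close> the hypothesis reads \<open>2 (s + y) < 1 + s\<^sup>2 - x\<close>, and because of
  \<open>w \<le> s\<close> the discriminant is at least \<open>(1 + s\<^sup>2 - x)\<^sup>2 - 4 (s + y)\<^sup>2\<close>. Moreover
  \<open>2 l h = b - \<surd>D < b = 1 - s\<^sup>2 + x\<close>, and adding this to the hypothesis gives the third claim. The last one is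
  \<open>l h\<^sup>2 - b h + c = 0\<close>, rearranged and divided by \<open>1 - l h\<close>.\<close>

lemma quadratic_bound:
  fixes k w l dA dQ b c D h :: real
  assumes l: "0 < l" and w: "0 \<le> w" and dA: "0 \<le> dA" and dQ: "0 \<le> dQ"
    and wk: "w\<^sup>2 \<le> k" and k: "k < 1"
    and b: "b = 1 - k + l * dQ" and c: "c = dQ + 2 * w * dA + l * dA\<^sup>2"
    and D: "D = b\<^sup>2 - 4 * c * l" and h: "h = (b - sqrt D) / (2 * l)"
    and cond: "2 * dA + dQ < (1 - sqrt k)\<^sup>2 / l"
  shows "0 < D" "0 \<le> h" "l * h + w + l * dA < 1"
    "dQ + (k * h + 2 * w * dA + l * dA\<^sup>2) / (1 - l * h) = h"
proof -
  define s where "s = sqrt k"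
  have k0: "0 \<le> k" using wk zero_le_power2[of w] by linarith
  have s: "0 \<le> s" "s\<^sup>2 = k" using k0 by (auto simp: s_def)
  have ws: "w \<le> s" unfolding s_def using wk by (rule real_le_rsqrt)
  define x where "x = l * dQ"
  define y where "y = l * dA"
  have xy: "0 \<le> x" "0 \<le> y" using l dA dQ by (auto simp: x_def y_def)
  have cond': "2 * y + x < (1 - s)\<^sup>2"
    using cond l by (simp add: x_def y_def s_def field_simps)
  then have gap: "2 * (s + y) < 1 + s\<^sup>2 - x" by (simp add: power2_eq_square algebra_simps)
  have "2 * w * dA * l \<le> 2 * s * dA * l"
    using ws dA l by (intro mult_right_mono) auto
  then have "(1 + s\<^sup>2 - x)\<^sup>2 - (2 * (s + y))\<^sup>2 \<le> D"
    unfolding D b c s(2)[symmetric] x_def y_def by (simp add: power2_eq_square algebra_simps)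
  moreover have "(2 * (s + y))\<^sup>2 < (1 + s\<^sup>2 - x)\<^sup>2"
    using gap s xy by (intro power_strict_mono) auto
  ultimately show D0: "0 < D" by linarith
  have c0: "0 \<le> c" using w dA dQ l by (simp add: c)
  have b0: "0 < b" using k xy by (simp add: b x_def)
  have "sqrt D \<le> sqrt (b\<^sup>2)" using c0 l by (intro real_sqrt_le_mono) (simp add: D)
  then have "sqrt D \<le> b" using b0 by simp
  then show "0 \<le> h" using l by (simp add: h)
  have lh: "l * h = (b - sqrt D) / 2" using l by (simp add: h)
  define t where "t = sqrt D"
  have "0 < t" using D0 by (simp add: t_def)
  moreover have "2 * (l * h) = 1 - s\<^sup>2 + x - t"
    using lh by (simp add: t_def x_def b s(2))
  ultimately have "2 * (l * h) < 1 - s\<^sup>2 + x" by linarith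
  then show small: "l * h + w + l * dA < 1"
    using gap ws by (simp add: y_def)
  have "l * h < 1" using small w xy by (simp add: y_def)
  moreover have "l * h\<^sup>2 - b * h + c = 0"
  proof -
    have "l * (l * h\<^sup>2 - b * h + c) = (l * h)\<^sup>2 - b * (l * h) + c * l"
      by (simp add: power2_eq_square algebra_simps)
    also have "\<dots> = ((sqrt D)\<^sup>2 - (b\<^sup>2 - 4 * c * l)) / 4"
      unfolding lh by (simp add: power2_eq_square field_simps)
    also have "\<dots> = 0" using D0 D by simp
    finally show ?thesis using l by simp
  qed
  ultimately show "dQ + (k * h + 2 * w * dA + l * dA\<^sup>2) / (1 - l * h) = h"
    by (simp add: b c field_simps power2_eq_square)
qed

section \<open>Congruence of the equation\<close>

definition congr :: "complex mat \<Rightarrow> complex mat \<Rightarrow> complex mat" where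
  "congr R X = R * X * R"

definition congr_hat :: "nat \<Rightarrow> complex mat \<Rightarrow> complex mat \<Rightarrow> complex mat" where
  "congr_hat m R A = hat m R * A * R"

text \<open>For \<open>R = P\<^sup>-\<^sup>1\<close>. The situation is symmetric in \<open>R\<close> and \<open>P\<close>, so that every transformation by \<open>R\<close> can be
  undone by the same lemmas for \<open>P\<close>.\<close>

locale inverse_pair =
  fixes n :: nat and R P :: "complex mat"
  assumes R: "hermitian_mat n R" and P: "hermitian_mat n P" and RP: "R * P = 1\<^sub>m n"
begin

lemma RP_dims [simp]: "dim_row R = n" "dim_col R = n" "dim_row P = n" "dim_col P = n"
  using R P by (auto simp: hermitian_mat_def)

lemma RP_adj: "mat_adjoint R = R" "mat_adjoint P = P"
  using R P by (auto simp: hermitian_mat_def)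

lemma PR: "P * R = 1\<^sub>m n"
  using R P RP by (auto simp: hermitian_mat_def intro: mat_mult_left_right_inverse[OF _ _ RP])

lemma swapped: "inverse_pair n P R"
  using R P PR by unfold_locales

lemma cancel:
  "dim_row M = n \<Longrightarrow> R * (P * M) = M" "dim_row M = n \<Longrightarrow> P * (R * M) = M"
  using RP PR by (simp_all add: one_mult_dim flip: mult_assoc_dim)

lemma cancel_hat:
  "dim_row M = m * n \<Longrightarrow> hat m R * (hat m P * M) = M" "dim_row M = m * n \<Longrightarrow> hat m P * (hat m R * M) = M"
  using RP PR by (simp_all add: one_mult_dim flip: mult_assoc_dim hat_mult)

lemma congr_inverse: "X \<in> carrier_mat n n \<Longrightarrow> congr P (congr R X) = X"
  using RP PR cancel by (simp add: congr_def mult_assoc_dim one_mult_dim)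

lemma congr_hat_inverse: "A \<in> carrier_mat (m * n) n \<Longrightarrow> congr_hat m P (congr_hat m R A) = A"
  using RP PR cancel_hat by (simp add: congr_hat_def mult_assoc_dim one_mult_dim)

lemma congr_hermitian: "hermitian_mat n X \<Longrightarrow> hermitian_mat n (congr R X)"
  using RP_adj by (auto simp: hermitian_mat_def congr_def adjoint_mult mult_assoc_dim intro!: carrier_matI)

lemma congr_quadratic:
  assumes "X \<in> carrier_mat n n" "dim_vec v = n"
  shows "(congr R X *\<^sub>v v) \<bullet>c v = (X *\<^sub>v (R *\<^sub>v v)) \<bullet>c (R *\<^sub>v v)"
proof -
  have "congr R X *\<^sub>v v = R *\<^sub>v (X *\<^sub>v (R *\<^sub>v v))"
    using assms by (simp add: congr_def mult_mult_vec_dim)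
  then show ?thesis
    using scalar_prod_adjoint[of "X *\<^sub>v (R *\<^sub>v v)" R v] assms RP_adj by simp
qed

lemma congr_pos_semidef:
  assumes "pos_semidef_mat n X"
  shows "pos_semidef_mat n (congr R X)"
proof -
  have X: "hermitian_mat n X" "X \<in> carrier_mat n n"
    using assms by (auto simp: pos_semidef_mat_def hermitian_mat_def)
  have "0 \<le> Re ((congr R X *\<^sub>v v) \<bullet>c v)" if "dim_vec v = n" for v
    unfolding congr_quadratic[OF X(2) that]
    using assms carrier_vecI[of "R *\<^sub>v v" n] by (simp add: pos_semidef_mat_def)
  then show ?thesis using congr_hermitian[OF X(1)] by (auto simp: pos_semidef_mat_def)
qed

lemma congr_pos_def:
  assumes "pos_def_mat n X"
  shows "pos_def_mat n (congr R X)"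
proof -
  have X: "hermitian_mat n X" "X \<in> carrier_mat n n"
    using assms by (auto simp: pos_def_mat_def hermitian_mat_def)
  have "0 < Re ((congr R X *\<^sub>v v) \<bullet>c v)" if v: "dim_vec v = n" "v \<noteq> 0\<^sub>v n" for v
  proof -
    have "P *\<^sub>v (R *\<^sub>v v) = v" using PR v by (simp add: one_mult_vec_dim flip: mult_mult_vec_dim)
    moreover have "P *\<^sub>v 0\<^sub>v n = 0\<^sub>v n" by (intro eq_vecI) (auto simp: scalar_prod_def)
    ultimately have "R *\<^sub>v v \<noteq> 0\<^sub>v n" using v(2) by auto
    then show ?thesis
      unfolding congr_quadratic[OF X(2) v(1)]
      using assms carrier_vecI[of "R *\<^sub>v v" n] by (simp add: pos_def_mat_def)
  qed
  then show ?thesis using congr_hermitian[OF X(1)] by (auto simp: pos_def_mat_def)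
qed

lemma congr_mat_inv:
  assumes X: "X \<in> carrier_mat n n" "invertible_mat X"
  shows "mat_inv (congr R X) = congr P (mat_inv X)" "invertible_mat (congr R X)"
proof -
  note I = mat_inv_invertible[OF X]
  have [simp]: "dim_row X = n" "dim_col X = n" "dim_row (mat_inv X) = n" "dim_col (mat_inv X) = n"
    using X I by auto
  have "X * (mat_inv X * P) = P" using I by (simp add: one_mult_dim flip: mult_assoc_dim)
  then have "congr R X * congr P (mat_inv X) = 1\<^sub>m n"
    using RP cancel by (simp add: congr_def mult_assoc_dim)
  moreover have "congr R X \<in> carrier_mat n n" "congr P (mat_inv X) \<in> carrier_mat n n"
    by (auto simp: congr_def intro!: carrier_matI)
  ultimately show "mat_inv (congr R X) = congr P (mat_inv X)" "invertible_mat (congr R X)"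
    using mat_inv_eqI by blast+
qed

lemma congr_solution:
  assumes sol: "hermitian_solution m n A Q X" and A: "A \<in> carrier_mat (m * n) n"
  shows "hermitian_solution m n (congr_hat m R A) (congr R Q) (congr R X)"
proof -
  have X: "X \<in> carrier_mat n n" "invertible_mat X" "hermitian_mat n X"
    and eq: "X + mat_adjoint A * mat_inv (hat m X) * A = Q"
    using sol by (auto simp: hermitian_solution_def hermitian_mat_def)
  note I = mat_inv_invertible[OF X(1,2)] and J = congr_mat_inv[OF X(1,2)]
  have [simp]: "dim_row X = n" "dim_col X = n" "dim_row (mat_inv X) = n" "dim_col (mat_inv X) = n"
    "dim_row A = m * n" "dim_col A = n"
    using X I A by auto
  have cR: "congr R X \<in> carrier_mat n n" by (auto simp: congr_def intro!: carrier_matI)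
  have "mat_adjoint (congr_hat m R A) * mat_inv (hat m (congr R X)) * congr_hat m R A
      = R * (mat_adjoint A * (hat m R * (hat m (P * mat_inv X * P) * (hat m R * (A * R)))))"
    unfolding mat_inv_hat[OF cR J(2)] J(1) congr_hat_def
    using RP_adj by (simp add: congr_def adjoint_mult mult_assoc_dim flip: hat_adjoint)
  also have "\<dots> = R * (mat_adjoint A * (hat m (mat_inv X) * (A * R)))"
    using cancel_hat by (simp add: hat_mult mult_assoc_dim)
  finally have "congr R X + mat_adjoint (congr_hat m R A) * mat_inv (hat m (congr R X)) * congr_hat m R A
      = congr R (X + mat_adjoint A * mat_inv (hat m X) * A)"
    unfolding mat_inv_hat[OF X(1,2)] by (simp add: congr_def mat_dim_algebra)
  then show ?thesis
    using eq J(2) congr_hermitian[OF X(3)] by (simp add: hermitian_solution_def)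
qed

lemma congr_loewner_ge:
  assumes "loewner_ge n X Y" "X \<in> carrier_mat n n" "Y \<in> carrier_mat n n"
  shows "loewner_ge n (congr R X) (congr R Y)"
proof -
  have "congr R (X - Y) = congr R X - congr R Y"
    using assms by (simp add: congr_def mat_dim_algebra)
  then show ?thesis using congr_pos_semidef[of "X - Y"] assms(1) by (simp add: loewner_ge_def)
qed

text \<open>A competing solution of the transformed equation is transformed back by \<open>P\<close>, compared with \<open>X\<close>,
  and the resulting inequality is transformed forth by \<open>R\<close>.\<close>

lemma congr_maximal:
  assumes max: "maximal_pos_def_solution m n A Q X" and A: "A \<in> carrier_mat (m * n) n"
    and Q: "Q \<in> carrier_mat n n"
  shows "maximal_pos_def_solution m n (congr_hat m R A) (congr R Q) (congr R X)"
proof -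
  have sol: "hermitian_solution m n A Q X" and pd: "pos_def_mat n X"
    and ge: "\<And>Y. hermitian_solution m n A Q Y \<Longrightarrow> loewner_ge n X Y"
    using max by (auto simp: maximal_pos_def_solution_def maximal_solution_def)
  have X: "X \<in> carrier_mat n n" using pd by (auto simp: pos_def_mat_def hermitian_mat_def)
  interpret rev: inverse_pair n P R by (rule swapped)
  have "loewner_ge n (congr R X) Y"
    if Y: "hermitian_solution m n (congr_hat m R A) (congr R Q) Y" for Y
  proof -
    have cY: "Y \<in> carrier_mat n n" using Y by (auto simp: hermitian_solution_def hermitian_mat_def)
    have "congr_hat m R A \<in> carrier_mat (m * n) n" by (auto simp: congr_hat_def intro!: carrier_matI)
    from rev.congr_solution[OF Y this] have "hermitian_solution m n A Q (congr P Y)"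
      using congr_inverse[OF Q] congr_hat_inverse[OF A] by simp
    then have "loewner_ge n X (congr P Y)" by (rule ge)
    moreover have "congr P Y \<in> carrier_mat n n" by (auto simp: congr_def intro!: carrier_matI)
    ultimately have "loewner_ge n (congr R X) (congr R (congr P Y))"
      using congr_loewner_ge X by blast
    then show ?thesis using rev.congr_inverse[OF cY] by simp
  qed
  then show ?thesis
    using congr_solution[OF sol A] congr_pos_def[OF pd]
    by (simp add: maximal_pos_def_solution_def maximal_solution_def)
qed

end

section \<open>Norms of block diagonal repetitions\<close>

lemma theta_bound:
  assumes \<nu>: "unitarily_invariant_norm \<nu>" and \<theta>: "is_theta \<nu> m n \<theta>" and H: "H \<in> carrier_mat n n"
  shows "\<nu> (hat m H) \<le> \<theta> * \<nu> H"
proof (cases "H = 0\<^sub>m n n")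
  case True
  then show ?thesis by (simp add: uin_zero[OF \<nu>])
next
  case False
  then have "\<theta> = \<nu> (hat m H) / \<nu> H" using \<theta> H by (auto simp: is_theta_def)
  moreover have "\<nu> H \<noteq> 0" using \<nu> H False by (auto simp: unitarily_invariant_norm_def)
  ultimately show ?thesis by simp
qed

text \<open>The identity of size \<open>n\<close> is the compression \<open>E\<^sup>* (hat I) E\<close> to the first \<open>n\<close> coordinates, and
  compressions do not increase \<open>\<nu>\<close>. This is what makes \<open>K \<ge> \<parallel>W\<parallel>\<close>.\<close>

lemma theta_ge_one:
  assumes \<nu>: "unitarily_invariant_norm \<nu>" and \<theta>: "is_theta \<nu> m n \<theta>" and m: "m \<ge> 1" and n: "n \<ge> 1"
  shows "1 \<le> \<theta>"
proof -
  have ne: "(1\<^sub>m n :: complex mat) \<noteq> 0\<^sub>m n n"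
  proof
    assume eq: "(1\<^sub>m n :: complex mat) = 0\<^sub>m n n"
    have "(1\<^sub>m n :: complex mat) $$ (0, 0) = 0\<^sub>m n n $$ (0, 0)" by (subst eq) simp
    then show False using n by simp
  qed
  have "\<nu> (1\<^sub>m n) \<noteq> 0"
    using conjunct1[OF \<nu>[unfolded unitarily_invariant_norm_def]] ne one_carrier_mat[of n] by metis
  then have pos: "0 < \<nu> (1\<^sub>m n)"
    using uin_nonneg[OF \<nu>, of "1\<^sub>m n"] by linarith
  define E where "E = mat (m * n) n (\<lambda>(i, j). if i = j then 1 else 0 :: complex)"
  have [simp]: "dim_row E = m * n" "dim_col E = n" by (auto simp: E_def)
  have nm: "n \<le> m * n" using m by simp
  have EE: "mat_adjoint E * E = 1\<^sub>m n"
  proof (rule eq_matI)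
    fix i j assume ij: "i < dim_row (1\<^sub>m n)" "j < dim_col (1\<^sub>m n)"
    have "(mat_adjoint E * E) $$ (i, j) = (\<Sum>k<m * n. cnj (E $$ (k, i)) * E $$ (k, j))"
      using ij by (simp add: scalar_prod_def atLeast0LessThan)
    also have "\<dots> = (\<Sum>k<m * n. if k = i then (if i = j then 1 else 0) else 0)"
      by (intro sum.cong) (use ij in \<open>auto simp: E_def\<close>)
    also have "\<dots> = 1\<^sub>m n $$ (i, j)" using ij less_le_trans[OF _ nm, of j] by simp
    finally show "(mat_adjoint E * E) $$ (i, j) = 1\<^sub>m n $$ (i, j)" .
  qed auto
  have E1: "spectral_norm E \<le> 1"
  proof (rule spectral_least)
    fix v :: "complex vec" assume v: "dim_vec v = dim_col E"
    have "(E *\<^sub>v v) \<bullet>c (E *\<^sub>v v) = v \<bullet>c (mat_adjoint E * E *\<^sub>v v)"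
      using v scalar_prod_adjoint[of v E "E *\<^sub>v v"] by (simp add: mult_mult_vec_dim)
    then have "(l2_vec_norm (E *\<^sub>v v))\<^sup>2 = (l2_vec_norm v)\<^sup>2"
      using v by (simp add: EE one_mult_vec_dim flip: l2_sq)
    then show "l2_vec_norm (E *\<^sub>v v) \<le> 1 * l2_vec_norm v" by simp
  qed simp
  have "\<nu> (1\<^sub>m n) = \<nu> (mat_adjoint E * hat m (1\<^sub>m n) * E)"
    using EE by (simp add: one_mult_dim)
  also have "\<dots> \<le> spectral_norm (mat_adjoint E) * \<nu> (hat m (1\<^sub>m n)) * spectral_norm E"
    by (rule uin_mult3[OF \<nu>]) auto
  also have "\<dots> \<le> 1 * \<nu> (hat m (1\<^sub>m n)) * 1"
    using E1 uin_nonneg[OF \<nu>] by (intro mult_mono) (auto simp: spectral_adjoint)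
  finally show ?thesis using \<theta> ne pos by (auto simp: is_theta_def)
qed

section \<open>The perturbation bound\<close>

theorem theorem3p5:
  fixes m n :: nat
    and Q A \<Delta>A \<Delta>Q XL P W :: "complex mat"
    and \<nu> :: "complex mat \<Rightarrow> real"
    and \<theta> K l dA dQ b c D S :: real
  assumes m: "m \<ge> 1" and n: "n \<ge> 1"
    and Q: "pos_def_mat n Q"
    and A: "A \<in> carrier_mat (m * n) n"
    and \<Delta>A: "\<Delta>A \<in> carrier_mat (m * n) n"
    and \<Delta>Q: "hermitian_mat n \<Delta>Q"
    and Qt: "pos_def_mat n (Q + \<Delta>Q)"
    and XL: "maximal_pos_def_solution m n A Q XL"
    and P: "pos_def_mat n P"
    and \<nu>: "unitarily_invariant_norm \<nu>"
    and \<theta>: "is_theta \<nu> m n \<theta>"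
    and W: "W = hat m (P * mat_inv XL) * A * mat_inv P"
    and l: "l = spectral_norm (P * mat_inv XL * P)"
    and dA: "dA = \<nu> (hat m (mat_inv P) * \<Delta>A * mat_inv P)"
    and dQ: "dQ = \<nu> (mat_inv P * \<Delta>Q * mat_inv P)"
    and K: "K = min (\<theta> * spectral_norm W) (\<nu> W)"
    and b: "b = 1 - K * spectral_norm W + l * dQ"
    and c: "c = dQ + 2 * spectral_norm W * dA + l * dA\<^sup>2"
    and D: "D = b\<^sup>2 - 4 * c * l"
    and S: "S = (spectral_norm P)\<^sup>2 * ((b - sqrt D) / (2 * l))"
    and cond1: "K * spectral_norm W < 1"
    and cond2: "2 * dA + dQ < (1 - sqrt (K * spectral_norm W))\<^sup>2 / l"
  shows "D > 0 \<and>
    (\<forall>XLt. maximal_pos_def_solution m n (A + \<Delta>A) (Q + \<Delta>Q) XLt \<longrightarrow> \<nu> (XLt - XL) \<le> S)"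
proof -
  have hP: "hermitian_mat n P" "P \<in> carrier_mat n n" and iP: "invertible_mat P"
    using P pos_def_invertible[OF P] by (auto simp: pos_def_mat_def hermitian_mat_def)
  define R where "R = mat_inv P"
  note IP = mat_inv_invertible[OF hP(2) iP, folded R_def]
  have hR: "hermitian_mat n R"
    using IP(1) mat_inv_hermitian[OF hP(1) iP] by (simp add: hermitian_mat_def R_def)
  interpret RP: inverse_pair n R P using hR hP IP by unfold_locales
  interpret PR: inverse_pair n P R by (rule RP.swapped)
  have pdX: "pos_def_mat n XL" and solX: "hermitian_solution m n A Q XL"
    using XL by (auto simp: maximal_pos_def_solution_def maximal_solution_def)
  have hX: "hermitian_mat n XL" "XL \<in> carrier_mat n n" and iX: "invertible_mat XL"
    using pdX pos_def_invertible[OF pdX] by (auto simp: pos_def_mat_def hermitian_mat_def)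
  have cQ: "Q \<in> carrier_mat n n" "\<Delta>Q \<in> carrier_mat n n"
    using Q \<Delta>Q by (auto simp: pos_def_mat_def hermitian_mat_def)
  define X where "X = congr R XL"
  define V where "V = congr P (mat_inv XL)"
  define A' where "A' = congr_hat m R A"
  define \<Delta>' where "\<Delta>' = congr_hat m R \<Delta>A"
  define Q' where "Q' = congr R Q"
  define \<Delta>Q' where "\<Delta>Q' = congr R \<Delta>Q"
  note IX = mat_inv_invertible[OF hX(2) iX]
  have [simp]: "dim_row XL = n" "dim_col XL = n" "dim_row (mat_inv XL) = n" "dim_col (mat_inv XL) = n"
    "dim_row A = m * n" "dim_col A = n" "dim_row \<Delta>A = m * n" "dim_col \<Delta>A = n"
    "dim_row Q = n" "dim_col Q = n" "dim_row \<Delta>Q = n" "dim_col \<Delta>Q = n"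
    using hX IX A \<Delta>A cQ by auto
  have [simp]: "dim_row X = n" "dim_col X = n" "dim_row V = n" "dim_col V = n"
    "dim_row A' = m * n" "dim_col A' = n" "dim_row \<Delta>' = m * n" "dim_col \<Delta>' = n"
    by (auto simp: X_def V_def A'_def \<Delta>'_def congr_def congr_hat_def)
  have invX: "mat_inv X = V" and iX': "invertible_mat X"
    using RP.congr_mat_inv[OF hX(2) iX] by (auto simp: X_def V_def)
  have cX': "X \<in> carrier_mat n n" by (auto intro!: carrier_matI)
  have hV: "hermitian_mat n V"
    unfolding V_def
    by (rule PR.congr_hermitian) (use IX mat_inv_hermitian[OF hX(1) iX] in \<open>simp add: hermitian_mat_def\<close>)
  have XV: "X * V = 1\<^sub>m n" using mat_inv_invertible[OF cX' iX'] by (simp add: invX)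
  have W': "W = hat m V * A'"
    unfolding W V_def A'_def congr_def congr_hat_def R_def[symmetric]
    using RP.cancel_hat by (simp add: hat_mult mult_assoc_dim)
  have l': "l = spectral_norm V" by (simp add: l V_def congr_def)
  have dA': "dA = \<nu> \<Delta>'" and dQ': "dQ = \<nu> \<Delta>Q'"
    by (simp_all add: dA dQ \<Delta>'_def \<Delta>Q'_def congr_def congr_hat_def R_def)
  have solX': "hermitian_solution m n A' Q' X"
    unfolding A'_def Q'_def X_def by (rule RP.congr_solution[OF solX A])
  define w where "w = spectral_norm W"
  define h where "h = (b - sqrt D) / (2 * l)"
  have w0: "0 \<le> w" by (simp add: w_def)
  have "1 \<le> \<theta>" by (rule theta_ge_one[OF \<nu> \<theta> m n])
  then have "w \<le> \<theta> * w" using w0 mult_right_mono[of 1 \<theta> w] by simp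
  then have "w \<le> K" using spectral_le_uin[OF \<nu>, of W] by (simp add: K w_def)
  then have wK: "w\<^sup>2 \<le> K * w" and K0: "0 \<le> K"
    using w0 by (simp_all add: power2_eq_square mult_right_mono)
  have l0: "0 < l"
  proof (rule ccontr)
    assume "\<not> 0 < l"
    then have "spectral_norm V \<le> 0" by (simp add: l')
    then have "V = 0\<^sub>m n n" by (intro eq_matI) (auto simp: spectral_norm_zero_entry)
    then have "(1\<^sub>m n :: complex mat) = 0\<^sub>m n n" using XV by (simp add: zero_mult_dim)
    then have "(1\<^sub>m n :: complex mat) $$ (0, 0) = 0\<^sub>m n n $$ (0, 0)" by (rule arg_cong)
    then show False using n by simp
  qed
  have quad: "0 < D" "0 \<le> h" "l * h + w + l * dA < 1"
    "dQ + (K * w * h + 2 * w * dA + l * dA\<^sup>2) / (1 - l * h) = h"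
    using quadratic_bound[OF l0 w0 _ _ wK _ _ _ D h_def, of dA dQ]
      uin_nonneg[OF \<nu>] cond1 cond2 b c by (simp_all add: dA' dQ' w_def)
  have "\<nu> (XLt - XL) \<le> S" if XLt: "maximal_pos_def_solution m n (A + \<Delta>A) (Q + \<Delta>Q) XLt" for XLt
  proof -
    have "perturbation m n X V A' \<Delta>' \<Delta>Q' \<nu> \<theta> K w l dA dQ h"
    proof
      show "hermitian_mat n X" unfolding X_def by (rule RP.congr_hermitian[OF hX(1)])
      show "hermitian_mat n \<Delta>Q'" unfolding \<Delta>Q'_def by (rule RP.congr_hermitian[OF \<Delta>Q])
    qed (use \<nu> theta_bound[OF \<nu> \<theta>] hV XV l' dA' dQ' quad K K0 W' w_def in \<open>auto intro!: carrier_matI\<close>)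
    then interpret perturbation m n X V A' \<Delta>' \<Delta>Q' \<nu> \<theta> K w l dA dQ h .
    obtain H where H: "hermitian_mat n H" "\<nu> H \<le> h" "invertible_mat (X + H)"
      and eqH: "X + H + mat_adjoint (A' + \<Delta>') * mat_inv (hat m (X + H)) * (A' + \<Delta>')
        = X + mat_adjoint A' * (hat m V * A') + \<Delta>Q'"
      and contr: "spectral_norm (hat m (mat_inv (X + H)) * (A' + \<Delta>')) < 1"
      using perturbed_solution_exists by blast
    have [simp]: "dim_row H = n" "dim_col H = n" using H(1) by (auto simp: hermitian_mat_def)
    have Q'_eq: "X + mat_adjoint A' * (hat m V * A') = Q'"
      using solX' mat_inv_hat[OF cX' iX'] by (simp add: hermitian_solution_def invX mult_assoc_dim)
    have "hermitian_mat n (X + H)"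
      using H(1) adj(1) by (auto simp: hermitian_mat_def adjoint_add intro!: carrier_matI)
    then have solH: "hermitian_solution m n (A' + \<Delta>') (Q' + \<Delta>Q') (X + H)"
      using eqH H(3) Q'_eq by (simp add: hermitian_solution_def)
    have sums: "congr_hat m R (A + \<Delta>A) = A' + \<Delta>'" "congr R (Q + \<Delta>Q) = Q' + \<Delta>Q'"
      by (simp_all add: A'_def \<Delta>'_def Q'_def \<Delta>Q'_def congr_def congr_hat_def mat_dim_algebra)
    have max: "maximal_pos_def_solution m n (A' + \<Delta>') (Q' + \<Delta>Q') (congr R XLt)"
      unfolding sums[symmetric] by (rule RP.congr_maximal[OF XLt]) (auto intro!: carrier_matI)
    \<comment> \<open>Maximality of the given solution puts it above the constructed one.\<close>
    have "congr R XLt = X + H"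
    proof (rule loewner_ge_imp_eq[OF _ _ solH _ _ contr])
      show "pos_def_mat n (congr R XLt)"
        "hermitian_solution m n (A' + \<Delta>') (Q' + \<Delta>Q') (congr R XLt)"
        "loewner_ge n (congr R XLt) (X + H)"
        using max solH by (auto simp: maximal_pos_def_solution_def maximal_solution_def)
    qed (auto intro!: carrier_matI)
    moreover have cXt: "XLt \<in> carrier_mat n n"
      using XLt by (auto simp: maximal_pos_def_solution_def pos_def_mat_def hermitian_mat_def)
    ultimately have "XLt = congr P (X + H)" using RP.congr_inverse by metis
    also have "\<dots> = congr P X + congr P H" by (simp add: congr_def mat_dim_algebra)
    also have "congr P X = XL" unfolding X_def by (rule RP.congr_inverse[OF hX(2)])
    finally have "XLt - XL = P * H * P"
      by (simp add: congr_def) (rule eq_matI, auto simp del: index_mult_mat(1))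
    then have "\<nu> (XLt - XL) \<le> spectral_norm P * \<nu> H * spectral_norm P"
      using uin_mult3[OF \<nu>, of P H P] by simp
    also have "\<dots> = (spectral_norm P)\<^sup>2 * \<nu> H" by (simp add: power2_eq_square mult_ac)
    also have "\<dots> \<le> S" unfolding S h_def[symmetric] using H(2) by (intro mult_left_mono) auto
    finally show ?thesis .
  qed
  then show ?thesis using quad(1) by blast
qed

end
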